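(* Let $k$ be an algebraically closed field of characteristic zero. There exists no nonsingular quartic surface $V(f)\subset P^3$ over $k$ such that $\mathrm{Paut}(V(f))$ contains a subgroup isomorphic to the alternating group $\mathbf{A}_6$. Hence there exists no nonsingular quartic surface $V(f)\subset P^3$ over $k$ such that $\mathrm{Paut}(V(f))$ contains a subgroup isomorphic to the symmetric group $\mathbf{S}_6$.
   Context: For a nonzero homogeneous polynomial $f\in k[x,y,z,t]$ of degree 4, $V(f)=\{(a)\in P^3: f(a)=0\}$ is the quartic surface defined by $f$; it is nonsingular if there is no $(a)\in V(f)$ at which all first partial derivatives of $f$ vanish. $\mathrm{Paut}(V(f))=\{(A)\in PGL_4(k): (A)V(f)=V(f)\}$, where $(A)$ is the class of $A\in GL_4(k)$ acting on $P^3$. *)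

theory Defs
  imports
    "HOL-Analysis.Cartesian_Space"
    "HOL-Library.Numeral_Type"
    "HOL-Library.Poly_Mapping"
    "HOL-Computational_Algebra.Polynomial"
    "HOL-Algebra.Coset"
    "HOL-Algebra.Sym_Groups"
begin

section \<open>Polynomials\<close>

text \<open>
  Polynomials over \<open>'k\<close> in the variables \<open>X i\<close>, \<open>i :: 'n\<close>: finitely supported maps from
  exponent vectors to coefficients. For \<open>'n = 4\<close> this is \<open>k[x, y, z, t]\<close>.
\<close>

type_synonym ('k, 'n) mpoly = "('n \<Rightarrow>\<^sub>0 nat) \<Rightarrow>\<^sub>0 'k"

definition mpoly_eval :: "('k::comm_ring_1, 'n::finite) mpoly \<Rightarrow> 'k ^ 'n \<Rightarrow> 'k" where
  "mpoly_eval f a =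
     (\<Sum>m\<in>Poly_Mapping.keys f.
        Poly_Mapping.lookup f m * (\<Prod>i\<in>UNIV. (a $ i) ^ Poly_Mapping.lookup m i))"

definition homogeneous :: "nat \<Rightarrow> ('k::zero, 'n::finite) mpoly \<Rightarrow> bool" where
  "homogeneous d f \<longleftrightarrow>
     (\<forall>m\<in>Poly_Mapping.keys f. (\<Sum>i\<in>UNIV. Poly_Mapping.lookup m i) = d)"

text \<open>
  Formal partial derivative. A monomial \<open>m\<close> not involving \<open>X i\<close> contributes
  \<open>of_nat 0 * _ = 0\<close>, so the truncated subtraction of exponents is harmless.
\<close>

definition partial_deriv :: "'n \<Rightarrow> ('k::comm_ring_1, 'n::finite) mpoly \<Rightarrow> ('k, 'n) mpoly" where
  "partial_deriv i f =
     (\<Sum>m\<in>Poly_Mapping.keys f.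
        Poly_Mapping.single (m - Poly_Mapping.single i 1)
          (of_nat (Poly_Mapping.lookup m i) * Poly_Mapping.lookup f m))"


section \<open>Projective hypersurfaces\<close>

text \<open>The point \<open>(a)\<close> of projective space: the class of \<open>a\<close> modulo nonzero scalars.\<close>

definition proj_point :: "'k::field ^ 'n \<Rightarrow> ('k ^ 'n) set" where
  "proj_point a = {c *s a | c. c \<noteq> 0}"

definition proj_space :: "('k::field ^ 'n) set set" where
  "proj_space = proj_point ` {a. a \<noteq> 0}"

definition hypersurface :: "('k::field, 'n::finite) mpoly \<Rightarrow> ('k ^ 'n) set set" where
  "hypersurface f = {P \<in> proj_space. \<forall>a\<in>P. mpoly_eval f a = 0}"

text \<open>
  As in the classical convention, this is a condition on the equation \<open>f\<close> and not only on
  the point set \<open>V(f)\<close>.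
\<close>

definition nonsingular :: "('k::field, 'n::finite) mpoly \<Rightarrow> bool" where
  "nonsingular f \<longleftrightarrow>
     \<not> (\<exists>P\<in>hypersurface f. \<forall>a\<in>P. \<forall>i. mpoly_eval (partial_deriv i f) a = 0)"

definition nonsingular_quartic :: "('k::field, 4) mpoly \<Rightarrow> bool" where
  "nonsingular_quartic f \<longleftrightarrow> f \<noteq> 0 \<and> homogeneous 4 f \<and> nonsingular f"


section \<open>Projective linear groups\<close>

definition GL :: "('k::field ^ 'n ^ 'n::finite) monoid" where
  "GL = \<lparr>carrier = {A. invertible A}, mult = (**), one = mat 1\<rparr>"

definition scalar_matrices :: "('k::field ^ 'n ^ 'n::finite) set" where
  "scalar_matrices = {mat c | c. c \<noteq> 0}"

definition PGL :: "('k::field ^ 'n ^ 'n::finite) set monoid" where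
  "PGL = GL Mod scalar_matrices"

text \<open>
  The action of a class \<open>(A)\<close> on a point \<open>(a)\<close>, both regarded as sets of representatives;
  see \<open>proj_act_class\<close> below for \<open>(A)(a) = (A a)\<close>.
\<close>

definition proj_act :: "('k::field ^ 'n ^ 'n::finite) set \<Rightarrow> ('k ^ 'n) set \<Rightarrow> ('k ^ 'n) set" where
  "proj_act C P = {A *v a | A a. A \<in> C \<and> a \<in> P}"

definition Paut :: "('k::field, 'n::finite) mpoly \<Rightarrow> ('k ^ 'n ^ 'n) set monoid" where
  "Paut f = PGL\<lparr>carrier := {C \<in> carrier PGL. proj_act C ` hypersurface f = hypersurface f}\<rparr>"

definition contains_subgroup_iso :: "('a, 'b) monoid_scheme \<Rightarrow> ('c, 'd) monoid_scheme \<Rightarrow> bool" where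
  "contains_subgroup_iso G K \<longleftrightarrow> (\<exists>H. subgroup H G \<and> G\<lparr>carrier := H\<rparr> \<cong> K)"


section \<open>Basic properties\<close>

lemma mpoly_eval_homogeneous:
  assumes "homogeneous d f"
  shows "mpoly_eval f (c *s a) = c ^ d * mpoly_eval f a"
proof -
  have "Poly_Mapping.lookup f m * (\<Prod>i\<in>UNIV. ((c *s a) $ i) ^ Poly_Mapping.lookup m i)
      = c ^ d * (Poly_Mapping.lookup f m * (\<Prod>i\<in>UNIV. (a $ i) ^ Poly_Mapping.lookup m i))" if "m \<in> Poly_Mapping.keys f" for m
    using that assms
    by (simp add: homogeneous_def power_mult_distrib prod.distrib flip: power_sum)
  then show ?thesis
    by (simp add: mpoly_eval_def sum_distrib_left)
qed

lemma mem_proj_point: "a \<in> proj_point a"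
  unfolding proj_point_def by (force intro: exI[of _ 1])

lemma proj_point_in_hypersurface:
  assumes "homogeneous d f" "a \<noteq> 0"
  shows "proj_point a \<in> hypersurface f \<longleftrightarrow> mpoly_eval f a = 0"
proof
  assume "proj_point a \<in> hypersurface f"
  then show "mpoly_eval f a = 0"
    using mem_proj_point by (auto simp: hypersurface_def)
next
  assume "mpoly_eval f a = 0"
  then show "proj_point a \<in> hypersurface f"
    using assms(2) mpoly_eval_homogeneous[OF assms(1)]
    by (auto simp: hypersurface_def proj_space_def proj_point_def)
qed

lemma mat_mult_eq_smult: "mat c ** A = (\<chi> i j. c * A $ i $ j)"
  and mult_mat_eq_smult: "A ** mat c = (\<chi> i j. c * A $ i $ j)"
  for A :: "'k::field ^ 'n ^ 'n::finite"
  by (simp_all add: matrix_matrix_mult_def mat_def vec_eq_iff if_distrib if_distribR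
      sum.delta sum.delta' mult.commute cong: if_cong)

lemma mat_vector_mult: "mat c *v a = c *s a" for a :: "'k::field ^ 'n::finite"
  by (simp add: matrix_vector_mult_def mat_def vec_eq_iff if_distrib if_distribR
      sum.delta sum.delta' cong: if_cong)

lemma mat_mult_mat: "mat c ** mat d = (mat (c * d) :: 'k::field ^ 'n ^ 'n::finite)"
  by (subst mat_mult_eq_smult) (simp add: mat_def vec_eq_iff)

lemma group_GL: "group (GL :: ('k::field ^ 'n ^ 'n::finite) monoid)"
proof (rule groupI)
  fix A :: "'k ^ 'n ^ 'n"
  assume "A \<in> carrier GL"
  then show "\<exists>B\<in>carrier GL. B \<otimes>\<^bsub>GL\<^esub> A = \<one>\<^bsub>GL\<^esub>"
    by (auto simp: GL_def invertible_def)
next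
  show "\<one>\<^bsub>GL\<^esub> \<in> carrier (GL :: ('k ^ 'n ^ 'n) monoid)"
    by (auto simp: GL_def invertible_def intro: exI[of _ "mat 1"])
qed (auto simp: GL_def invertible_mult matrix_mul_assoc)

lemma normal_scalar_matrices: "scalar_matrices \<lhd> (GL :: ('k::field ^ 'n ^ 'n::finite) monoid)"
proof -
  interpret group "GL :: ('k ^ 'n ^ 'n) monoid" by (rule group_GL)
  have inv_mat: "inv\<^bsub>GL\<^esub> (mat c) = (mat (inverse c) :: 'k ^ 'n ^ 'n)"
    and invertible_mat: "invertible (mat c :: 'k ^ 'n ^ 'n)" if "c \<noteq> 0" for c
  proof -
    have *: "mat c ** mat (inverse c) = (mat 1 :: 'k ^ 'n ^ 'n)"
      "mat (inverse c) ** mat c = (mat 1 :: 'k ^ 'n ^ 'n)"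
      using that by (simp_all add: mat_mult_mat)
    then show "invertible (mat c :: 'k ^ 'n ^ 'n)"
      by (auto simp: invertible_def)
    from * show "inv\<^bsub>GL\<^esub> (mat c) = (mat (inverse c) :: 'k ^ 'n ^ 'n)"
      by (intro inv_equality) (auto simp: GL_def invertible_def)
  qed
  have sub: "subgroup (scalar_matrices :: ('k ^ 'n ^ 'n) set) GL"
  proof (rule subgroupI)
    show "(scalar_matrices :: ('k ^ 'n ^ 'n) set) \<subseteq> carrier GL"
      using invertible_mat by (auto simp: scalar_matrices_def GL_def)
    show "(scalar_matrices :: ('k ^ 'n ^ 'n) set) \<noteq> {}"
      by (auto simp: scalar_matrices_def intro: exI[of _ 1])
    show "inv\<^bsub>GL\<^esub> A \<in> scalar_matrices" if "A \<in> scalar_matrices" for A :: "'k ^ 'n ^ 'n"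
      using that inv_mat by (auto simp: scalar_matrices_def intro: exI[of _ "inverse _"])
    show "A \<otimes>\<^bsub>GL\<^esub> B \<in> scalar_matrices" if "A \<in> scalar_matrices" "B \<in> scalar_matrices"
      for A B :: "'k ^ 'n ^ 'n"
      using that by (auto simp: scalar_matrices_def GL_def mat_mult_mat intro: exI[of _ "_ * _"])
  qed
  have comm: "A ** S = S ** A" if "S \<in> scalar_matrices" for A S :: "'k ^ 'n ^ 'n"
    using that by (auto simp: scalar_matrices_def mat_mult_eq_smult mult_mat_eq_smult)
  show ?thesis
  proof (rule normalI[OF sub], intro ballI)
    fix A :: "'k ^ 'n ^ 'n"
    show "scalar_matrices #>\<^bsub>GL\<^esub> A = A <#\<^bsub>GL\<^esub> scalar_matrices"
    proof -
      have "(\<Union>S\<in>scalar_matrices. {S ** A}) = (\<Union>S\<in>scalar_matrices. {A ** S})"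
        by (rule SUP_cong[OF refl]) (simp only: comm[of _ A])
      then show ?thesis
        by (simp add: GL_def r_coset_def l_coset_def)
    qed
  qed
qed

lemma group_PGL: "group (PGL :: ('k::field ^ 'n ^ 'n::finite) set monoid)"
  unfolding PGL_def by (rule normal.factorgroup_is_group[OF normal_scalar_matrices])

lemma proj_act_class:
  fixes A :: "'k::field ^ 'n ^ 'n::finite"
  shows "proj_act (scalar_matrices #>\<^bsub>GL\<^esub> A) (proj_point a) = proj_point (A *v a)"
proof -
  have eq: "(mat c ** A) *v (d *s a) = (c * d) *s (A *v a)" for c d
    by (simp add: matrix_vector_mul_assoc [symmetric] mat_vector_mult vec.scale)
  have "proj_act (scalar_matrices #>\<^bsub>GL\<^esub> A) (proj_point a)
      = {(mat c ** A) *v (d *s a) | c d. c \<noteq> 0 \<and> d \<noteq> 0}"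
    by (fastforce simp: proj_act_def r_coset_def scalar_matrices_def GL_def proj_point_def)
  also have "\<dots> = {(c * d) *s (A *v a) | c d. c \<noteq> 0 \<and> d \<noteq> 0}"
    by (simp only: eq)
  also have "\<dots> = proj_point (A *v a)"
  proof (rule Set.set_eqI)
    fix x
    have "(\<exists>c d. x = (c * d) *s (A *v a) \<and> c \<noteq> 0 \<and> d \<noteq> 0)" if "x = e *s (A *v a)" "e \<noteq> 0" for e
      using that by (intro exI[of _ e] exI[of _ 1]) simp
    moreover have "(\<exists>e. x = e *s (A *v a) \<and> e \<noteq> 0)"
      if "x = (c * d) *s (A *v a)" "c \<noteq> 0" "d \<noteq> 0" for c d
      using that by (intro exI[of _ "c * d"]) simp
    ultimately show "x \<in> {(c * d) *s (A *v a) | c d. c \<noteq> 0 \<and> d \<noteq> 0} \<longleftrightarrow> x \<in> proj_point (A *v a)"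
      unfolding proj_point_def mem_Collect_eq by blast
  qed
  finally show ?thesis .
qed

end

theory Submission
  imports Defs "HOL-Analysis.Determinants"
begin

text \<open>
  The obstruction is a subgroup of order 36, namely \<open>3\<^sup>2 : 4\<close>, which lies in both groups: it is
  generated by \<open>a = (1 2 3)\<close>, \<open>b = (4 5 6)\<close> and \<open>s = (1 4)(2 5 3 6)\<close>, where conjugation by \<open>s\<close>
  maps \<open>a\<close> to \<open>b\<close> and \<open>b\<close> to the inverse of \<open>a\<close>. No nonsingular quartic admits such a group of
  projective symmetries, for the following reason.

  Choose matrices \<open>A\<close>, \<open>B\<close>, \<open>S\<close> in the classes of \<open>a\<close>, \<open>b\<close>, \<open>s\<close>. They satisfy the relations up to
  scalars; after rescaling \<open>A\<close> and \<open>B\<close> the relations hold exactly, with \<open>A\<^sup>3 = B\<^sup>3 = 1\<close>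
  (\<open>no_nonsingular_quartic_with_projective_symmetries\<close>). A matrix that maps \<open>V(f)\<close> into itself
  multiplies \<open>f\<close> by a constant (\<open>zero_set_symmetry_scales_nonsingular_form\<close>). For \<open>A\<close> and \<open>B\<close> this
  constant is a character \<open>\<chi>\<close> with \<open>\<chi>(A) = \<chi>(B) = 1 / \<chi>(A)\<close> and \<open>\<chi>(A)\<^sup>3 = 1\<close>, so it is \<open>1\<close>:
  \<open>f\<close> is invariant under \<open>A\<close> and \<open>B\<close>.

  A joint eigenvector \<open>v\<close> of \<open>A\<close> and \<open>B\<close> with eigenvalues \<open>(\<alpha>, \<beta>)\<close>, \<open>\<alpha> \<noteq> 1\<close>, is moved by the powers
  of \<open>S\<close> to joint eigenvectors with the four distinct pairs of eigenvalues \<open>(\<alpha>, \<beta>)\<close>,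
  \<open>(1/\<beta>, \<alpha>)\<close>, \<open>(1/\<alpha>, 1/\<beta>)\<close>, \<open>(\<beta>, 1/\<alpha>)\<close>, none of which is \<open>(1, 1)\<close>. They form a basis of
  \<open>k\<^sup>4\<close>. Invariance gives \<open>f(v) = \<alpha>\<^sup>4 f(v) = \<alpha> f(v)\<close>, hence \<open>f(v) = 0\<close>. The derivative of \<open>f\<close> at \<open>v\<close>
  is a linear form fixed by \<open>A\<close> and \<open>B\<close>, since \<open>\<alpha>\<^sup>3 = \<beta>\<^sup>3 = 1\<close>; so it vanishes on joint eigenvectors
  whose eigenvalues are not both \<open>1\<close>, that is, on the whole basis. Thus \<open>v\<close> is a singular point
  (\<open>no_invariant_nonsingular_quartic\<close>). With coordinates \<open>x, y\<close> along
  \<open>v, S\<^sup>2 v\<close> and \<open>z, t\<close> along \<open>S v, S\<^sup>3 v\<close>, the form \<open>f\<close> is a combination of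
  \<open>x\<^sup>2 y\<^sup>2\<close>, \<open>x y z t\<close> and \<open>z\<^sup>2 t\<^sup>2\<close>.

  The passage from the point set \<open>V(f)\<close> to the form \<open>f\<close> is the longest part. It is a special case
  of the Nullstellensatz, for which nonsingularity makes a direct argument possible. Fix \<open>p\<close> with
  \<open>f(p) \<noteq> 0\<close> and put \<open>R(x) = f(p) f(A x) - f(A p) f(x)\<close>, which vanishes on \<open>V(f)\<close>. On a
  line \<open>q + t p\<close> the polynomial \<open>R\<close> has smaller degree in \<open>t\<close> than \<open>f\<close>, so it suffices that each root
  of \<open>f\<close> on the line, of multiplicity \<open>e\<close>, is a root of \<open>R\<close> of multiplicity at least \<open>e\<close>. At such a
  root some direction \<open>u\<close> is transversal to \<open>V(f)\<close>. In the plane \<open>q + s u + t p\<close>, where \<open>f\<close> is monic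
  in \<open>t\<close> up to a constant, \<open>f\<close> divides \<open>R\<^sup>d\<close> (\<open>dvd_if_dvd_at_constants\<close>), and the curve \<open>f = 0\<close>
  has a formal parametrization \<open>s = \<phi>(t)\<close> near the root, where \<open>\<phi>\<close> vanishes to order at least \<open>e\<close>
  (\<open>truncated_implicit_root\<close>). Along it \<open>R\<close> vanishes to any required order, and replacing \<open>\<phi>\<close>
  by \<open>0\<close> changes \<open>R\<close> only by a multiple of \<open>\<phi>\<close>.
\<close>

section \<open>Roots and divisibility of univariate polynomials\<close>

lemma dvd_power_if_roots:
  fixes p q :: "'a::alg_closed_field poly"
  assumes "p \<noteq> 0" "degree p \<le> n" "\<And>x. poly p x = 0 \<Longrightarrow> poly q x = 0"
  shows "p dvd q ^ n"
  using assms
proof (induction n arbitrary: p)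
  case 0
  then show ?case by (simp add: is_unit_iff_degree)
next
  case (Suc n)
  show ?case
  proof (cases "degree p = 0")
    case True
    then show ?thesis using Suc.prems by (simp add: is_unit_iff_degree unit_imp_dvd)
  next
    case False
    then obtain x where x: "poly p x = 0"
      using alg_closed_imp_poly_has_root by blast
    then obtain p' where p': "p = [:-x, 1:] * p'"
      using poly_eq_0_iff_dvd by (metis dvdE)
    have "p' \<noteq> 0" using Suc.prems(1) p' by auto
    then have "degree p = Suc (degree p')"
      unfolding p' by (subst degree_mult_eq) auto
    then have "p' dvd q ^ n"
      using Suc.prems \<open>p' \<noteq> 0\<close> by (intro Suc.IH) (auto simp: p')
    moreover have "[:-x, 1:] dvd q"
      using Suc.prems(3)[OF x] poly_eq_0_iff_dvd by blast
    ultimately show ?thesis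
      unfolding p' power_Suc by (rule mult_dvd_mono[rotated])
  qed
qed

lemma dvd_if_root_orders:
  fixes p q :: "'a::alg_closed_field poly"
  assumes "p \<noteq> 0" "\<And>x. [:-x, 1:] ^ Polynomial.order x p dvd q"
  shows "p dvd q"
  using assms
proof (induction "degree p" arbitrary: p q)
  case 0
  then show ?case by (simp add: is_unit_iff_degree unit_imp_dvd)
next
  case (Suc n)
  show ?case
  proof (cases "q = 0")
    case False
    obtain x where x: "poly p x = 0"
      using alg_closed_imp_poly_has_root Suc.hyps(2) by (metis zero_less_Suc)
    then obtain p' where p': "p = [:-x, 1:] * p'"
      using poly_eq_0_iff_dvd by (metis dvdE)
    have p'0: "p' \<noteq> 0" using Suc.prems(1) p' by auto
    have "[:-x, 1:] ^ 1 dvd [:-x, 1:] ^ Polynomial.order x p"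
      using x Suc.prems(1) by (intro le_imp_power_dvd) (simp add: Suc_leI order_gt_0_iff)
    then have "[:-x, 1:] dvd q"
      using Suc.prems(2)[of x] dvd_trans by auto
    then obtain q' where q': "q = [:-x, 1:] * q'"
      by (rule dvdE)
    have "degree p = Suc (degree p')"
      unfolding p' using p'0 by (subst degree_mult_eq) auto
    moreover have "[:-y, 1:] ^ Polynomial.order y p' dvd q'" for y
      using Suc.prems(2)[of y] False Suc.prems(1) order_mult[of "[:-x, 1:]" p' y]
        order_mult[of "[:-x, 1:]" q' y]
      unfolding order_divides p' q' by auto
    ultimately have "p' dvd q'"
      using Suc.hyps p'0 by auto
    then show ?thesis unfolding p' q' by (rule mult_dvd_mono[OF dvd_refl])
  qed simp
qed

section \<open>Polynomials in two variables\<close>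

text \<open>
  A polynomial in \<open>s\<close> and \<open>t\<close> is an element of \<open>'k poly poly\<close> with \<open>s\<close> as the outer variable. Then
  substituting a polynomial \<open>\<phi>(t)\<close> for \<open>s\<close> is plain evaluation, \<open>poly P \<phi>\<close>.
\<close>

lemma poly_const_altdef:
  "poly P [:a:] = (\<Sum>i\<le>degree P. smult (a ^ i) (coeff P i))"
  for P :: "'k::comm_ring_1 poly poly"
proof -
  have "coeff P i * [:a:] ^ i = smult (a ^ i) (coeff P i)" for i
    by (induction i) (auto simp: mult_ac poly_const_pow)
  then show ?thesis by (simp add: poly_altdef)
qed

text \<open>
  The assumptions say that \<open>F\<close>, as a polynomial in the inner variable, has degree \<open>d\<close> and a constant
  leading coefficient; therefore division with remainder with respect to the inner variable works.
\<close>

lemma division_by_monic_in_inner_variable: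
  fixes F P :: "'k::field poly poly"
  assumes F0: "degree (coeff F 0) = d"
    and F_less: "\<And>i. i > 0 \<Longrightarrow> degree (coeff F i) < d"
  shows "\<exists>Q S. P = Q * F + S \<and> (\<forall>i. degree (coeff S i) < d)"
proof -
  have d: "d > 0" using F_less[of 1] by simp
  define l where "l = coeff (coeff F 0) d"
  have l: "l \<noteq> 0" unfolding l_def using F0 d by (metis degree_0 leading_coeff_0_iff less_irrefl)
  have *: "\<exists>Q S. P = Q * F + S \<and> (\<forall>i. degree (coeff S i) < d)"
    if "\<And>i. degree (coeff P i) < n" for n P
    using that
  proof (induction n arbitrary: P)
    case (Suc n)
    show ?case
    proof (cases "n < d")
      case True
      then have "\<forall>i. degree (coeff P i) < d"
        using Suc.prems by (meson less_le_trans Suc_leI)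
      moreover have "P = 0 * F + P" by simp
      ultimately show ?thesis by blast
    next
      case False
      \<comment> \<open>\<open>M * F\<close> has the same terms of degree \<open>n\<close> in the inner variable as \<open>P\<close>\<close>
      define M where "M = map_poly (\<lambda>c. monom (coeff c n / l) (n - d)) P"
      have M: "coeff M i = monom (coeff (coeff P i) n / l) (n - d)" for i
        by (simp add: M_def coeff_map_poly)
      have deg_M: "degree (coeff M i) \<le> n - d" for i
        by (simp add: M degree_monom_le)
      have "degree (coeff (P - M * F) i) < n" for i
      proof -
        have le: "degree (coeff M j * coeff F (i - j)) < n" if "j < i" for j
        proof -
          have "degree (coeff M j * coeff F (i - j)) \<le> degree (coeff M j) + degree (coeff F (i - j))"
            by (rule degree_mult_le)
          also have "\<dots> < n"
            using deg_M[of j] F_less[of "i - j"] that False by simp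
          finally show ?thesis .
        qed
        have split: "coeff (P - M * F) i
            = (coeff P i - coeff M i * coeff F 0) - (\<Sum>j<i. coeff M j * coeff F (i - j))"
          by (simp add: coeff_mult lessThan_Suc_atMost[symmetric])
        have n: "n > 0" using False d by simp
        have "degree (\<Sum>j<i. coeff M j * coeff F (i - j)) < n"
          using n le by (intro degree_sum_less) auto
        moreover have "degree (coeff P i - coeff M i * coeff F 0) < n"
        proof -
          have "coeff (coeff P i - coeff M i * coeff F 0) m = 0" if m: "m \<ge> n" for m
          proof (cases "m = n")
            case True
            then show ?thesis using False l by (simp add: M coeff_monom_mult l_def)
          next
            case neq: False
            have "coeff (coeff P i) m = 0"
              using Suc.prems[of i] m neq by (intro coeff_eq_0) simp
            moreover have "coeff (coeff F 0) (m - (n - d)) = 0"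
              using m neq False F0 by (intro coeff_eq_0) simp
            ultimately show ?thesis by (simp add: M coeff_monom_mult)
          qed
          then have "degree (coeff P i - coeff M i * coeff F 0) \<le> n - 1"
            using n by (intro degree_le) auto
          then show ?thesis using n by simp
        qed
        ultimately show ?thesis unfolding split by (rule degree_diff_less[rotated])
      qed
      from Suc.IH[OF this] obtain Q S where "P - M * F = Q * F + S" "\<forall>i. degree (coeff S i) < d"
        by blast
      then show ?thesis
        by (intro exI[of _ "Q + M"] exI[of _ S]) (auto simp: algebra_simps)
    qed
  qed simp
  have "degree (coeff P i) < Suc (\<Sum>i\<le>degree P. degree (coeff P i))" for i
  proof (cases "i \<le> degree P")
    case True
    then have "degree (coeff P i) \<le> (\<Sum>i\<le>degree P. degree (coeff P i))"
      by (intro member_le_sum) auto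
    then show ?thesis by simp
  next
    case False
    then show ?thesis by (simp add: coeff_eq_0)
  qed
  from *[OF this] show ?thesis .
qed

text \<open>
  The remainder of \<open>P\<close> modulo \<open>F\<close> becomes, for each constant value of the outer variable, a multiple
  of a polynomial of larger degree, so it is zero there; a polynomial over an infinite field with so
  many zeros vanishes.
\<close>

lemma dvd_if_dvd_at_constants:
  fixes F P :: "'k::field_char_0 poly poly"
  assumes F0: "degree (coeff F 0) = d"
    and F_less: "\<And>i. i > 0 \<Longrightarrow> degree (coeff F i) < d"
    and fibres: "\<And>a. poly F [:a:] dvd poly P [:a:]"
  shows "F dvd P"
proof -
  have d: "d > 0" using F_less[of 1] by simp
  obtain Q S where QS: "P = Q * F + S" and S: "\<And>i. degree (coeff S i) < d"
    using division_by_monic_in_inner_variable[OF F0 F_less] by metis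
  have "poly S [:a:] = 0" for a
  proof (rule ccontr)
    assume "poly S [:a:] \<noteq> 0"
    have "degree (poly S [:a:]) < d"
      unfolding poly_const_altdef using d S
      by (intro degree_sum_less) (auto intro: le_less_trans[OF degree_smult_le])
    moreover have "d \<le> degree (poly F [:a:])"
    proof (rule le_degree)
      have "coeff (smult (a ^ i) (coeff F i)) d = (if i = 0 then coeff (coeff F 0) d else 0)" for i
        using F_less[of i] by (simp add: coeff_eq_0)
      then have "coeff (poly F [:a:]) d = coeff (coeff F 0) d"
        by (simp add: poly_const_altdef coeff_sum)
      then show "coeff (poly F [:a:]) d \<noteq> 0"
        using F0 d by (metis degree_0 leading_coeff_0_iff less_irrefl)
    qed
    moreover have "poly F [:a:] dvd poly S [:a:]"
      using fibres[of a] unfolding QS by (simp add: dvd_add_right_iff)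
    ultimately show False
      using \<open>poly S [:a:] \<noteq> 0\<close> dvd_imp_degree_le by (metis not_le order_trans)
  qed
  then have "range (\<lambda>a. [:a:]) \<subseteq> {x. poly S x = 0}" by auto
  moreover have "infinite (range (\<lambda>a::'k. [:a:]))"
    using infinite_UNIV_char_0 by (subst finite_image_iff) (auto simp: inj_on_def)
  ultimately have "S = 0" using poly_roots_finite finite_subset by metis
  then show ?thesis using QS by simp
qed

lemma poly_add_second_order:
  "\<exists>r. poly P (x + \<delta>) = poly P x + \<delta> * poly (pderiv P) x + \<delta>^2 * r"
  for P :: "'a::idom poly"
proof (induction P)
  case (pCons a P)
  obtain r where r: "poly P (x + \<delta>) = poly P x + \<delta> * poly (pderiv P) x + \<delta>^2 * r"
    using pCons.IH by blast
  show ?case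
    by (rule exI[of _ "poly (pderiv P) x + x * r + \<delta> * r"])
      (unfold poly_pCons r pderiv_pCons poly_add, simp add: algebra_simps power2_eq_square)
qed simp

text \<open>
  The implicit function theorem at \<open>s = 0\<close>, \<open>t = z\<close> modulo a power of \<open>t - z\<close>, by successive
  approximation. If the curve meets the line \<open>s = 0\<close> with multiplicity at least \<open>e\<close>, then \<open>0\<close> is
  already a solution modulo \<open>(t - z)\<^sup>e\<close>, and all later corrections are multiples of \<open>(t - z)\<^sup>e\<close>.
\<close>

lemma truncated_implicit_root:
  fixes F :: "'k::field poly poly"
  assumes e: "e > 0" and F0: "[:-z, 1:] ^ e dvd coeff F 0"
    and F1: "poly (coeff F 1) z \<noteq> 0" and "e \<le> N"
  shows "\<exists>\<phi>. [:-z, 1:] ^ e dvd \<phi> \<and> [:-z, 1:] ^ N dvd poly F \<phi>"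
  using \<open>e \<le> N\<close>
proof (induction N rule: dec_induct)
  case base
  then show ?case using F0 by (intro exI[of _ 0]) (simp add: poly_0_coeff_0)
next
  case (step N)
  let ?\<pi> = "[:-z, 1:]"
  from step.IH obtain \<phi> G where \<phi>: "?\<pi> ^ e dvd \<phi>" and G: "poly F \<phi> = ?\<pi> ^ N * G"
    by (metis dvdE)
  define D where "D = poly (pderiv F) \<phi>"
  have \<pi>N: "poly (?\<pi> ^ N) z = 0" "poly (?\<pi> ^ e) z = 0" using e step by (auto simp: poly_power)
  then have "poly \<phi> z = 0" using \<phi> by (metis dvd_def mult_zero_left poly_mult)
  then have "poly (poly (pderiv F) \<phi>) z = poly (coeff (pderiv F) 0) z"
    by (cases "pderiv F") simp
  then have D: "poly D z \<noteq> 0" using F1 by (simp add: D_def coeff_pderiv)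
  \<comment> \<open>The Newton correction: it cancels the coefficient of \<open>(t - z)\<^sup>N\<close> in \<open>poly F \<phi>\<close>.\<close>
  define c where "c = - poly G z / poly D z"
  obtain r where r: "poly F (\<phi> + smult c (?\<pi> ^ N))
      = poly F \<phi> + smult c (?\<pi> ^ N) * D + (smult c (?\<pi> ^ N))^2 * r"
    using poly_add_second_order unfolding D_def by blast
  have "poly F (\<phi> + smult c (?\<pi> ^ N)) = ?\<pi> ^ N * (G + smult c D + smult (c^2) (?\<pi> ^ N * r))"
    unfolding r G by (simp add: algebra_simps power2_eq_square)
  moreover have "?\<pi> dvd G + smult c D + smult (c^2) (?\<pi> ^ N * r)"
    using \<pi>N D unfolding poly_eq_0_iff_dvd[symmetric] by (simp add: c_def)
  ultimately have "?\<pi> ^ Suc N dvd poly F (\<phi> + smult c (?\<pi> ^ N))"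
    by (simp only: power_Suc2 mult_dvd_mono dvd_refl)
  moreover have "?\<pi> ^ e dvd \<phi> + smult c (?\<pi> ^ N)"
    using \<phi> step.hyps by (intro dvd_add dvd_smult le_imp_power_dvd) auto
  ultimately show ?case by blast
qed

section \<open>Evaluating forms over polynomial rings\<close>

text \<open>
  Restricting a form to a line or to a plane is the same as evaluating it at a vector with entries in
  \<open>k[t]\<close> or \<open>k[t][s]\<close>. The map \<open>\<iota>\<close> embeds the coefficients into that ring.
\<close>

definition eval_in :: "('k::zero \<Rightarrow> 'a::comm_ring_1) \<Rightarrow> ('k, 'n::finite) mpoly \<Rightarrow> ('n \<Rightarrow> 'a) \<Rightarrow> 'a" where
  "eval_in \<iota> f x = (\<Sum>m\<in>Poly_Mapping.keys f.
     \<iota> (Poly_Mapping.lookup f m) * (\<Prod>i\<in>UNIV. x i ^ Poly_Mapping.lookup m i))"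

lemma mpoly_eval_eq_eval_in: "mpoly_eval f a = eval_in (\<lambda>c. c) f (\<lambda>i. a $ i)"
  by (simp add: mpoly_eval_def eval_in_def)

lemma poly_eval_in: "poly (eval_in \<iota> f x) a = eval_in (\<lambda>c. poly (\<iota> c) a) f (\<lambda>i. poly (x i) a)"
  by (simp add: eval_in_def poly_sum poly_prod)

lemma eval_in_eq_sum_superset:
  assumes "finite K" "Poly_Mapping.keys f \<subseteq> K" "\<iota> 0 = 0"
  shows "eval_in \<iota> f x = (\<Sum>m\<in>K. \<iota> (Poly_Mapping.lookup f m) * (\<Prod>i\<in>UNIV. x i ^ Poly_Mapping.lookup m i))"
  unfolding eval_in_def using assms
  by (intro sum.mono_neutral_left) (auto simp: in_keys_iff)

lemma eval_in_zero [simp]: "eval_in \<iota> 0 x = 0"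
  by (simp add: eval_in_def)

lemma eval_in_single:
  assumes "\<iota> 0 = 0"
  shows "eval_in \<iota> (Poly_Mapping.single m c) x = \<iota> c * (\<Prod>i\<in>UNIV. x i ^ Poly_Mapping.lookup m i)"
  by (subst eval_in_eq_sum_superset[where K = "{m}"]) (auto simp: assms)

lemma eval_in_add:
  fixes f g :: "('k::comm_ring_1, 'n::finite) mpoly"
  assumes "\<iota> 0 = 0" "\<And>a b. \<iota> (a + b) = \<iota> a + \<iota> b"
  shows "eval_in \<iota> (f + g) x = eval_in \<iota> f x + eval_in \<iota> g x"
proof -
  let ?K = "Poly_Mapping.keys f \<union> Poly_Mapping.keys g"
  have "Poly_Mapping.keys (f + g) \<subseteq> ?K" by (rule Poly_Mapping.keys_add)
  then show ?thesis
    using assms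
    by (subst (1 2 3) eval_in_eq_sum_superset[where K = ?K])
      (auto simp: lookup_add sum.distrib algebra_simps)
qed

lemma eval_in_sum:
  fixes F :: "'b \<Rightarrow> ('k::comm_ring_1, 'n::finite) mpoly"
  assumes "\<iota> 0 = 0" "\<And>a b. \<iota> (a + b) = \<iota> a + \<iota> b"
  shows "eval_in \<iota> (sum F A) x = (\<Sum>j\<in>A. eval_in \<iota> (F j) x)"
  by (induction A rule: infinite_finite_induct) (simp_all add: eval_in_add assms)

lemma eval_in_partial_deriv:
  fixes f :: "('k::comm_ring_1, 'n::finite) mpoly"
  assumes "\<iota> 0 = 0" "\<And>a b. \<iota> (a + b) = \<iota> a + \<iota> b" 
  shows "eval_in \<iota> (partial_deriv i f) x = (\<Sum>m\<in>Poly_Mapping.keys f. \<iota> (Poly_Mapping.lookup f m) *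
     (of_nat (Poly_Mapping.lookup m i) * x i ^ (Poly_Mapping.lookup m i - 1) *
        (\<Prod>j\<in>UNIV - {i}. x j ^ Poly_Mapping.lookup m j)))"
proof -
  have nat: "\<iota> (of_nat n * c) = of_nat n * \<iota> c" for n c
    by (induction n) (simp_all add: assms algebra_simps)
  have "(\<Prod>j\<in>UNIV. x j ^ Poly_Mapping.lookup (m - Poly_Mapping.single i 1) j)
      = x i ^ (Poly_Mapping.lookup m i - 1) * (\<Prod>j\<in>UNIV - {i}. x j ^ Poly_Mapping.lookup m j)" for m
    by (subst prod.remove[of _ i]) (auto simp: lookup_minus lookup_single intro!: prod.cong)
  then show ?thesis
    by (simp add: partial_deriv_def eval_in_sum eval_in_single assms nat) (simp add: mult_ac)
qed

text \<open>
  The chain rule for a form evaluated along a polynomial curve.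
\<close>

lemma pderiv_eval_in:
  fixes f :: "('k::comm_ring_1, 'n::finite) mpoly" and x :: "'n \<Rightarrow> 'a::idom poly"
  assumes "\<iota> 0 = 0" "\<And>a b. \<iota> (a + b) = \<iota> a + \<iota> b"
  shows "pderiv (eval_in (\<lambda>c. [:\<iota> c:]) f x)
     = (\<Sum>i\<in>UNIV. eval_in (\<lambda>c. [:\<iota> c:]) (partial_deriv i f) x * pderiv (x i))"
proof -
  let ?e = "\<lambda>m i. of_nat (Poly_Mapping.lookup m i) * x i ^ (Poly_Mapping.lookup m i - 1) *
        (\<Prod>j\<in>UNIV - {i}. x j ^ Poly_Mapping.lookup m j)"
  have mono: "pderiv (\<Prod>i\<in>UNIV. x i ^ Poly_Mapping.lookup m i) = (\<Sum>i\<in>UNIV. ?e m i * pderiv (x i))" for m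
    by (simp add: pderiv_prod pderiv_power of_nat_poly algebra_simps)
  have psum: "pderiv (sum F A) = (\<Sum>m\<in>A. pderiv (F m))" for F :: "_ \<Rightarrow> 'a poly" and A
    using higher_pderiv_sum[of 1] by simp
  have "pderiv (eval_in (\<lambda>c. [:\<iota> c:]) f x) =
      (\<Sum>m\<in>Poly_Mapping.keys f. [:\<iota> (Poly_Mapping.lookup f m):] * (\<Sum>i\<in>UNIV. ?e m i * pderiv (x i)))"
    unfolding eval_in_def psum pderiv_mult mono by simp
  also have "\<dots> = (\<Sum>i\<in>UNIV. (\<Sum>m\<in>Poly_Mapping.keys f. [:\<iota> (Poly_Mapping.lookup f m):] * ?e m i) * pderiv (x i))"
    unfolding sum_distrib_left sum_distrib_right by (subst sum.swap) (simp add: mult_ac)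
  finally show ?thesis
    using assms by (simp add: eval_in_partial_deriv)
qed

lemma coeff_mult_top:
  fixes p q :: "'a::comm_ring_1 poly"
  assumes "degree p \<le> m" "degree q \<le> n"
  shows "coeff (p * q) (m + n) = coeff p m * coeff q n"
proof -
  have "coeff p i * coeff q (m + n - i) = (if i = m then coeff p m * coeff q n else 0)" if "i \<le> m + n" for i
    using assms that by (cases i m rule: linorder_cases) (auto simp: coeff_eq_0)
  then show ?thesis by (simp add: coeff_mult)
qed

lemma top_coeff_prod_power:
  fixes x :: "'n::finite \<Rightarrow> 'a::comm_ring_1 poly"
  assumes "\<And>i. degree (x i) \<le> 1"
  shows "degree (\<Prod>i\<in>A. x i ^ e i) \<le> (\<Sum>i\<in>A. e i)
    \<and> coeff (\<Prod>i\<in>A. x i ^ e i) (\<Sum>i\<in>A. e i) = (\<Prod>i\<in>A. coeff (x i) 1 ^ e i)"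
proof -
  have pow: "degree (x i ^ n) \<le> n \<and> coeff (x i ^ n) n = coeff (x i) 1 ^ n" for i n
  proof (induction n)
    case (Suc n)
    then show ?case
      using assms[of i] coeff_mult_top[of "x i" 1 "x i ^ n" n] degree_mult_le[of "x i" "x i ^ n"]
      by simp
  qed simp
  have "finite A" by simp
  then show ?thesis
  proof (induction A)
    case (insert i A)
    then show ?case
      using pow[of i "e i"] coeff_mult_top[of "x i ^ e i" "e i" "\<Prod>i\<in>A. x i ^ e i" "\<Sum>i\<in>A. e i"]
        degree_mult_le[of "x i ^ e i" "\<Prod>i\<in>A. x i ^ e i"]
      by simp
  qed simp
qed

text \<open>
  Entries of degree at most one are those of a vector \<open>q + t p\<close>; the top coefficient of a form of
  degree \<open>d\<close> on this line is its value in the direction \<open>p\<close> of the line.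
\<close>

lemma
  fixes f :: "('k::comm_ring_1, 'n::finite) mpoly" and x :: "'n \<Rightarrow> 'a::comm_ring_1 poly"
  assumes f: "homogeneous d f" and x: "\<And>i. degree (x i) \<le> 1"
  shows degree_eval_in_le: "degree (eval_in (\<lambda>c. [:\<iota> c:]) f x) \<le> d"
    and top_coeff_eval_in: "coeff (eval_in (\<lambda>c. [:\<iota> c:]) f x) d = eval_in \<iota> f (\<lambda>i. coeff (x i) 1)"
proof -
  have *: "degree (\<Prod>i\<in>UNIV. x i ^ Poly_Mapping.lookup m i) \<le> d"
    "coeff (\<Prod>i\<in>UNIV. x i ^ Poly_Mapping.lookup m i) d = (\<Prod>i\<in>UNIV. coeff (x i) 1 ^ Poly_Mapping.lookup m i)"
    if "m \<in> Poly_Mapping.keys f" for m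
    using top_coeff_prod_power[where A = UNIV and e = "Poly_Mapping.lookup m", OF x] f that by (auto simp: homogeneous_def)
  show "degree (eval_in (\<lambda>c. [:\<iota> c:]) f x) \<le> d"
    unfolding eval_in_def
    using * by (intro degree_sum_le) (auto intro: order_trans[OF degree_smult_le])
  show "coeff (eval_in (\<lambda>c. [:\<iota> c:]) f x) d = eval_in \<iota> f (\<lambda>i. coeff (x i) 1)"
    using * by (simp add: eval_in_def coeff_sum)
qed

section \<open>Symmetries of the zero set of a nonsingular form\<close>

lemma mpoly_eval_partial_deriv_scale:
  fixes f :: "('k::field, 'n::finite) mpoly"
  assumes "homogeneous d f"
  shows "mpoly_eval (partial_deriv i f) (c *s v) = c ^ (d - 1) * mpoly_eval (partial_deriv i f) v"
proof -
  let ?e = "\<lambda>v m. of_nat (Poly_Mapping.lookup m i) * (v $ i) ^ (Poly_Mapping.lookup m i - 1) *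
        (\<Prod>j\<in>UNIV - {i}. (v $ j) ^ Poly_Mapping.lookup m j)"
  have scale: "?e (c *s v) m = c ^ (d - 1) * ?e v m" if "m \<in> Poly_Mapping.keys f" for m
  proof (cases "Poly_Mapping.lookup m i")
    case (Suc n)
    have "d = (\<Sum>j\<in>UNIV. Poly_Mapping.lookup m j)"
      using assms that by (simp add: homogeneous_def)
    also have "\<dots> = Suc (n + (\<Sum>j\<in>UNIV - {i}. Poly_Mapping.lookup m j))"
      by (subst sum.remove[of _ i]) (auto simp: Suc)
    finally have d: "d - 1 = n + (\<Sum>j\<in>UNIV - {i}. Poly_Mapping.lookup m j)" by simp
    show ?thesis unfolding d Suc
      by (simp add: power_mult_distrib prod.distrib power_add power_sum mult_ac)
  qed simp
  have eval: "mpoly_eval (partial_deriv i f) w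
      = (\<Sum>m\<in>Poly_Mapping.keys f. Poly_Mapping.lookup f m * ?e w m)" for w
    unfolding mpoly_eval_eq_eval_in by (rule eval_in_partial_deriv) simp_all
  show ?thesis
    unfolding eval sum_distrib_left
    by (intro sum.cong refl) (simp only: scale mult.left_commute)
qed

lemma nonsingular_gradient:
  fixes f :: "('k::field, 'n::finite) mpoly"
  assumes "homogeneous d f" "nonsingular f" "v \<noteq> 0" "mpoly_eval f v = 0"
  obtains i where "mpoly_eval (partial_deriv i f) v \<noteq> 0"
proof -
  have "proj_point v \<in> hypersurface f"
    using assms by (simp add: proj_point_in_hypersurface)
  then obtain a i where "a \<in> proj_point v" and a: "mpoly_eval (partial_deriv i f) a \<noteq> 0"
    using assms(2) unfolding nonsingular_def by blast
  then obtain c where "a = c *s v" unfolding proj_point_def by blast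
  with a assms(1) have "mpoly_eval (partial_deriv i f) v \<noteq> 0"
    by (auto simp: mpoly_eval_partial_deriv_scale)
  then show ?thesis by (rule that)
qed

text \<open>
  A bound on the total degree of a form restricted to a plane shows that only its constant
  coefficient can attain the full degree in the inner variable, as division requires.
\<close>

definition total_degree_le :: "nat \<Rightarrow> 'a::zero poly poly \<Rightarrow> bool" where
  "total_degree_le n P \<longleftrightarrow> (\<forall>i j. n < i + j \<longrightarrow> coeff (coeff P i) j = 0)"

lemma total_degree_le_mult:
  fixes P Q :: "'a::comm_ring_1 poly poly"
  assumes "total_degree_le m P" "total_degree_le n Q"
  shows "total_degree_le (m + n) (P * Q)"
  unfolding total_degree_le_def
proof (intro allI impI)
  fix i j assume ij: "m + n < i + j"
  have "coeff (coeff P a) b * coeff (coeff Q (i - a)) (j - b) = 0" if "a \<le> i" "b \<le> j" for a b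
  proof (cases "m < a + b")
    case False
    then have "n < (i - a) + (j - b)" using ij that by simp
    then show ?thesis using assms(2) by (simp add: total_degree_le_def)
  qed (use assms(1) in \<open>simp add: total_degree_le_def\<close>)
  then show "coeff (coeff (P * Q) i) j = 0"
    by (simp add: coeff_mult coeff_sum)
qed

lemma total_degree_le_prod_power:
  fixes x :: "'n::finite \<Rightarrow> 'a::comm_ring_1 poly poly"
  assumes "\<And>i. total_degree_le 1 (x i)"
  shows "total_degree_le (\<Sum>i\<in>A. e i) (\<Prod>i\<in>A. x i ^ e i)"
proof -
  have one: "total_degree_le 0 (1 :: 'a poly poly)"
    by (auto simp: total_degree_le_def coeff_1)
  have pow: "total_degree_le n (x i ^ n)" for i n
    using total_degree_le_mult[OF assms] by (induction n) (auto simp: one)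
  have "finite A" by simp
  then show ?thesis
    by (induction A) (auto simp: one intro!: total_degree_le_mult pow)
qed

lemma total_degree_le_eval_in:
  fixes f :: "('k::comm_ring_1, 'n::finite) mpoly" and x :: "'n \<Rightarrow> 'a::comm_ring_1 poly poly"
  assumes "homogeneous d f" "\<And>i. total_degree_le 1 (x i)"
  shows "total_degree_le d (eval_in (\<lambda>c. [:[:\<iota> c:]:]) f x)"
proof -
  have "total_degree_le d (\<Prod>i\<in>UNIV. x i ^ Poly_Mapping.lookup m i)" if "m \<in> Poly_Mapping.keys f" for m
    using total_degree_le_prod_power[of x "Poly_Mapping.lookup m" UNIV] assms that
    by (simp add: homogeneous_def)
  then show ?thesis
    by (simp add: eval_in_def total_degree_le_def coeff_sum)
qed

lemma dvd_poly_minus_constant: "\<phi> dvd poly P \<phi> - poly P 0" for \<phi> :: "'a::comm_ring_1"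
  by (cases P) simp

lemma root_power_dvd_cancel:
  fixes r :: "'a::idom poly"
  assumes "n > 0" "([:-z, 1:] ^ e) ^ n dvd r ^ n"
  shows "[:-z, 1:] ^ e dvd r"
proof (cases "r = 0")
  case False
  then have "Polynomial.order z (r ^ n) = n * Polynomial.order z r"
    by (induction n) (auto simp: order_mult)
  then show ?thesis using assms False
    by (simp add: order_divides mult.commute flip: power_mult)
qed simp

text \<open>
  A case of the Nullstellensatz: \<open>f \<circ> A\<close> vanishes on \<open>V(f)\<close> and has the same degree, so it is a multiple
  of \<open>f\<close>. Nonsingularity ensures that \<open>f\<close> has no multiple factors; it enters at the roots of \<open>f\<close> on the
  line through \<open>p\<close> and \<open>q\<close>, where it provides the direction needed for an implicit parametrization.
\<close>

lemma zero_set_symmetry_scales_nonsingular_form: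
  fixes f :: "('k::{alg_closed_field, field_char_0}, 'n::finite) mpoly" and A :: "'k ^ 'n ^ 'n"
  assumes f: "homogeneous d f" and d: "d > 0" and ns: "nonsingular f"
    and vanish: "\<And>v. mpoly_eval f v = 0 \<Longrightarrow> mpoly_eval f (A *v v) = 0"
    and p: "mpoly_eval f p \<noteq> 0"
  shows "mpoly_eval f p * mpoly_eval f (A *v q) = mpoly_eval f (A *v p) * mpoly_eval f q"
proof (cases "\<exists>z. q + z *s p = 0")
  \<comment> \<open>Here the line degenerates: it passes through the zero vector, which is no projective point.\<close>
  case True
  then obtain z where "q = (- z) *s p" by (metis add.inverse_unique vector_smult_lneg add.commute)
  then show ?thesis
    by (simp only: vec.scale mpoly_eval_homogeneous[OF f]) (simp add: vec.scale mpoly_eval_homogeneous[OF f])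
next
  case False
  \<comment> \<open>The line \<open>q + t p\<close>, the form \<open>f\<close> on it, and the comparison polynomial \<open>R\<close> for vectors over \<open>k[t]\<close>.\<close>
  define L where "L = (\<lambda>j. [:q $ j, p $ j:])"
  define F0 where "F0 = eval_in (\<lambda>c. [:c:]) f L"
  define R where "R = (\<lambda>w :: 'n \<Rightarrow> 'k poly. [:mpoly_eval f p:] * eval_in (\<lambda>c. [:c:]) f (\<lambda>i. \<Sum>j\<in>UNIV. [:A $ i $ j:] * w j)
       - [:mpoly_eval f (A *v p):] * eval_in (\<lambda>c. [:c:]) f w)"
  have deg_w: "degree (eval_in (\<lambda>c. [:c:]) f w) \<le> d" 
    and top_w: "coeff (eval_in (\<lambda>c. [:c:]) f w) d = mpoly_eval f p"
    if "\<And>j. degree (w j) \<le> 1" "\<And>j. coeff (w j) 1 = p $ j" for w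
    using that degree_eval_in_le[OF f, of w] top_coeff_eval_in[OF f, of w]
    by (simp_all add: mpoly_eval_eq_eval_in)
  have L: "degree (L j) \<le> 1" "coeff (L j) 1 = p $ j" for j by (simp_all add: L_def)
  have R_deg: "degree (R L) < d"
  proof -
    have AL: "degree (\<Sum>j\<in>UNIV. [:A $ i $ j:] * L j) \<le> 1" 
      "coeff (\<Sum>j\<in>UNIV. [:A $ i $ j:] * L j) 1 = (A *v p) $ i" for i
      using L by (auto intro!: degree_sum_le intro: order_trans[OF degree_smult_le]
          simp: coeff_sum matrix_vector_mult_def simp del: One_nat_def)
    have "degree (R L) \<le> d"
      unfolding R_def using degree_eval_in_le[OF f, of "\<lambda>i. \<Sum>j\<in>UNIV. [:A $ i $ j:] * L j"] AL deg_w[of L] L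
      by (intro degree_diff_le) (auto intro: order_trans[OF degree_smult_le])
    moreover have "coeff (R L) d = 0"
      unfolding R_def using top_coeff_eval_in[OF f, of "\<lambda>i. \<Sum>j\<in>UNIV. [:A $ i $ j:] * L j"] AL top_w[of L] L
      by (simp add: mpoly_eval_eq_eval_in)
    ultimately show ?thesis
      using d by (metis degree_0 leading_coeff_0_iff le_neq_implies_less)
  qed
  have F0: "degree F0 = d" "F0 \<noteq> 0"
  proof -
    have "coeff F0 d \<noteq> 0" using top_w[of L] L p by (simp add: F0_def)
    then show "degree F0 = d" "F0 \<noteq> 0"
      using deg_w[of L] L by (auto simp: F0_def intro: le_antisym le_degree)
  qed
  have "[:-z, 1:] ^ Polynomial.order z F0 dvd R L" for z
  proof (cases "Polynomial.order z F0 = 0")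
    case e0: False
    define e where "e = Polynomial.order z F0"
    define v where "v = q + z *s p"
    have v_eq: "eval_in (\<lambda>c. c) g (\<lambda>j. poly (L j) z) = mpoly_eval g v" for g
      by (simp add: L_def v_def mpoly_eval_eq_eval_in)
    have "poly F0 z = 0" using e0 by (simp add: order_root)
    then have "mpoly_eval f v = 0"
      by (simp add: F0_def poly_eval_in v_eq)
    moreover have "v \<noteq> 0" using False by (simp add: v_def)
    ultimately obtain i where i: "mpoly_eval (partial_deriv i f) v \<noteq> 0"
      using nonsingular_gradient[OF f ns] by blast
    \<comment> \<open>The plane \<open>q + t p + s u\<close>, where \<open>u\<close> is the \<open>i\<close>-th unit vector.\<close>
    define X where "X = (\<lambda>j. [:L j, if j = i then 1 else 0:])"
    define F where "F = eval_in (\<lambda>c. [:[:c:]:]) f X"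
    define G where "G = [:[:mpoly_eval f p:]:] * eval_in (\<lambda>c. [:[:c:]:]) f (\<lambda>i. \<Sum>j\<in>UNIV. [:[:A $ i $ j:]:] * X j)
       - [:[:mpoly_eval f (A *v p):]:] * F"
    have poly_F: "poly F \<phi> = eval_in (\<lambda>c. [:c:]) f (\<lambda>j. poly (X j) \<phi>)" for \<phi>
      by (simp add: F_def poly_eval_in)
    have poly_G: "poly G \<phi> = R (\<lambda>j. poly (X j) \<phi>)" for \<phi>
      by (simp add: G_def R_def F_def poly_eval_in poly_sum)
    have X0: "(\<lambda>j. poly (X j) 0) = L" by (simp add: X_def)
    have coeff_F0: "coeff F 0 = F0"
      by (simp add: poly_0_coeff_0[symmetric] poly_F X0 F0_def)
    have "pderiv (X j) = (if j = i then 1 else 0)" for j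
      by (simp add: X_def pderiv_pCons one_pCons)
    then have "pderiv F = eval_in (\<lambda>c. [:[:c:]:]) (partial_deriv i f) X"
      unfolding F_def by (subst pderiv_eval_in) (simp_all add: if_distrib[where f = "(*) _"] sum.delta cong: if_cong)
    then have "coeff (pderiv F) 0 = eval_in (\<lambda>c. [:c:]) (partial_deriv i f) L"
      by (simp add: poly_0_coeff_0[symmetric] poly_eval_in X0)
    then have F1: "poly (coeff F 1) z \<noteq> 0"
      using i by (simp add: coeff_pderiv poly_eval_in v_eq)
    have tX: "total_degree_le 1 (X j)" for j
      by (auto simp: total_degree_le_def X_def L_def coeff_pCons split: nat.splits)
    have F_less: "degree (coeff F k) < d" if "k > 0" for k
    proof -
      have "coeff (coeff F k) m = 0" if "m \<ge> d" for m
        using total_degree_le_eval_in[OF f tX, of "\<lambda>c. c"] that \<open>k > 0\<close>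
        unfolding total_degree_le_def F_def by simp
      then have "degree (coeff F k) \<le> d - 1" using d by (intro degree_le) auto
      then show ?thesis using d by simp
    qed
    have "F dvd G ^ d"
    proof (rule dvd_if_dvd_at_constants)
      show "degree (coeff F 0) = d" by (simp add: coeff_F0 F0)
      fix a
      have Xa: "degree (poly (X j) [:a:]) \<le> 1" "coeff (poly (X j) [:a:]) 1 = p $ j" for j
        by (simp_all add: X_def L_def)
      have "poly F [:a:] dvd (poly G [:a:]) ^ d"
      proof (rule dvd_power_if_roots)
        show "degree (poly F [:a:]) \<le> d" "poly F [:a:] \<noteq> 0"
          using deg_w[OF Xa] top_w[OF Xa] p unfolding poly_F by auto
        fix x assume x: "poly (poly F [:a:]) x = 0"
        define w where "w = (\<chi> j. poly (poly (X j) [:a:]) x)"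
        have "mpoly_eval f w = 0"
          using x by (simp add: poly_F poly_eval_in mpoly_eval_eq_eval_in w_def)
        with vanish[OF this] show "poly (poly G [:a:]) x = 0"
          by (simp add: poly_G R_def poly_eval_in poly_sum mpoly_eval_eq_eval_in w_def
              matrix_vector_mult_def)
      qed
      then show "poly F [:a:] dvd poly (G ^ d) [:a:]" by simp
    qed (rule F_less)
    then obtain Q where Q: "G ^ d = F * Q" by (rule dvdE)
    have e: "e > 0" "[:-z, 1:] ^ e dvd coeff F 0"
      using e0 by (simp_all add: e_def coeff_F0 order_1)
    \<comment> \<open>Order \<open>e * d\<close>, because only the \<open>d\<close>-th power of \<open>G\<close> is known to be divisible by \<open>F\<close>.\<close>
    obtain \<phi> where \<phi>: "[:-z, 1:] ^ e dvd \<phi>" "[:-z, 1:] ^ (e * d) dvd poly F \<phi>"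
      using truncated_implicit_root[OF e F1, of "e * d"] d by auto
    have "poly G \<phi> ^ d = poly F \<phi> * poly Q \<phi>"
      using arg_cong[OF Q, of "\<lambda>P. poly P \<phi>"] by simp
    with \<phi>(2) have "([:-z, 1:] ^ e) ^ d dvd poly G \<phi> ^ d"
      by (simp add: power_mult)
    then have "[:-z, 1:] ^ e dvd poly G \<phi>"
      by (rule root_power_dvd_cancel[OF d])
    moreover have "[:-z, 1:] ^ e dvd poly G \<phi> - poly G 0"
      using \<phi>(1) dvd_poly_minus_constant by (rule dvd_trans)
    ultimately have "[:-z, 1:] ^ e dvd poly G \<phi> - (poly G \<phi> - poly G 0)"
      by (rule dvd_diff)
    then show ?thesis by (simp add: poly_G X0 e_def)
  qed simp
  then have "F0 dvd R L" by (rule dvd_if_root_orders[OF F0(2)])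
  then have "R L = 0" using F0 R_deg dvd_imp_degree_le[of F0 "R L"] by auto
  then have "poly (R L) 0 = 0" by simp
  then show ?thesis
    by (simp add: R_def L_def poly_eval_in poly_sum mpoly_eval_eq_eval_in matrix_vector_mult_def)
qed

section \<open>Derivatives and joint eigenvectors\<close>

text \<open>
  Both sides are the derivative at \<open>t = 0\<close> of \<open>f(v + t w) = f(T (v + t w)) = a\<^sup>d f(v + t (b / a) w)\<close>.
\<close>

lemma gradient_along_eigenvectors:
  fixes f :: "('k::field_char_0, 'n::finite) mpoly" and T :: "'k ^ 'n ^ 'n"
  assumes f: "homogeneous d f" "d > 0" and inv: "\<And>x. mpoly_eval f (T *v x) = mpoly_eval f x"
    and v: "T *v v = a *s v" and w: "T *v w = b *s w" and a: "a \<noteq> 0"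
  defines "l \<equiv> (\<Sum>i\<in>UNIV. mpoly_eval (partial_deriv i f) v * w $ i)"
  shows "l = a ^ (d - 1) * b * l"
proof -
  define P where "P = eval_in (\<lambda>c. [:c:]) f (\<lambda>i. [:v $ i, w $ i:])"
  have P: "poly P t = mpoly_eval f (v + t *s w)" for t
    by (simp add: P_def poly_eval_in mpoly_eval_eq_eval_in)
  have "poly P t = poly (smult (a ^ d) (pcompose P [:0, b / a:])) t" for t
  proof -
    have "a *s (v + (t * (b / a)) *s w) = T *v (v + t *s w)"
      using a by (simp add: v w vec.add vec.scale vec_eq_iff field_simps)
    then show ?thesis
      by (simp add: P poly_pcompose inv flip: mpoly_eval_homogeneous[OF f(1)])
  qed
  then have "P = smult (a ^ d) (pcompose P [:0, b / a:])"
    by (intro poly_ext) blast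
  from arg_cong[OF this, of "\<lambda>p. poly (pderiv p) 0"]
  have "poly (pderiv P) 0 = a ^ d * (poly (pderiv P) 0 * (b / a))"
    by (simp add: pderiv_smult pderiv_pcompose poly_pcompose pderiv_pCons mult_ac)
  moreover have "poly (pderiv P) 0 = l"
    unfolding P_def l_def
    by (subst pderiv_eval_in)
      (simp_all add: poly_sum poly_eval_in mpoly_eval_eq_eval_in pderiv_pCons mult.commute)
  moreover have "a ^ d = a * a ^ (d - 1)"
    using f(2) by (cases d) auto
  ultimately have "l = a * a ^ (d - 1) * (l * (b / a))" by metis
  also have "\<dots> = a ^ (d - 1) * b * l" using a by simp
  finally show ?thesis .
qed

text \<open>
  A form without a nonzero value would have zero derivatives too, and then every point would be
  singular.
\<close>

lemma exists_nonvanishing_point: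
  fixes f :: "('k::field_char_0, 'n::finite) mpoly"
  assumes f: "homogeneous d f" "nonsingular f"
  shows "\<exists>p. mpoly_eval f p \<noteq> 0"
proof (rule ccontr)
  assume "\<not> ?thesis"
  then have zero: "mpoly_eval f x = 0" for x by blast
  define v :: "'k ^ 'n" where "v = 1"
  have "v \<noteq> 0" by (simp add: v_def)
  obtain i where i: "mpoly_eval (partial_deriv i f) v \<noteq> 0"
    using nonsingular_gradient[OF f \<open>v \<noteq> 0\<close> zero] .
  define P where "P = eval_in (\<lambda>c. [:c:]) f (\<lambda>j. [:v $ j, axis i 1 $ j:])"
  have "poly P t = mpoly_eval f (v + t *s axis i 1)" for t
    by (simp add: P_def poly_eval_in mpoly_eval_eq_eval_in)
  then have "P = 0" by (intro poly_ext) (simp add: zero)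
  then have "poly (pderiv P) 0 = 0" by simp
  moreover have "poly (pderiv P) 0 = mpoly_eval (partial_deriv i f) v"
    unfolding P_def
    by (subst pderiv_eval_in)
      (simp_all add: poly_sum poly_eval_in mpoly_eval_eq_eval_in pderiv_pCons,
        simp add: axis_def if_distrib[where f = "\<lambda>x. x * _"] sum.delta cong: if_cong)
  ultimately show False using i by simp
qed

text \<open>
  Write \<open>T\<^sup>3 - 1 = (T - \<omega>\<^sup>2) (T - \<omega>) (T - 1)\<close> and apply the factors to \<open>u\<close> from the right to the left;
  the last nonzero vector is an eigenvector.
\<close>

lemma exists_eigenvector_of_order_three:
  fixes T :: "'k::{alg_closed_field, field_char_0} ^ 'n ^ 'n::finite"
  assumes T3: "\<And>x. T *v (T *v (T *v x)) = x"
    and U: "vec.subspace U" "\<And>x. x \<in> U \<Longrightarrow> T *v x \<in> U" and u: "u \<in> U" "u \<noteq> 0"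
  obtains v b where "v \<in> U" "v \<noteq> 0" "b ^ 3 = 1" "T *v v = b *s v"
proof (cases "T *v u = u")
  case True
  then show ?thesis using that[of u 1] u by simp
next
  case False
  define y where "y = T *v u - u"
  have y: "y \<noteq> 0" "y \<in> U" using False u U by (auto simp: y_def vec.subspace_diff)
  have T2y: "T *v (T *v y) = - (T *v y) - y"
    by (simp add: y_def vec.diff T3)
  have "\<exists>\<omega>::'k. poly [:1, 1, 1:] \<omega> = 0"
    by (rule alg_closed_imp_poly_has_root) simp
  then obtain \<omega> :: 'k where \<omega>: "\<omega>\<^sup>2 = - \<omega> - 1"
    by (auto simp: power2_eq_square algebra_simps eq_neg_iff_add_eq_0)
  have \<omega>3: "\<omega> ^ 3 = 1" "(\<omega>\<^sup>2) ^ 3 = 1"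
  proof -
    have "\<omega> ^ 3 = \<omega> * \<omega>\<^sup>2" by (simp add: power3_eq_cube power2_eq_square)
    also have "\<dots> = - (\<omega>\<^sup>2) - \<omega>" by (subst \<omega>) (simp add: algebra_simps power2_eq_square)
    also have "\<dots> = 1" using \<omega> by simp
    finally show "\<omega> ^ 3 = 1" .
    then show "(\<omega>\<^sup>2) ^ 3 = 1" by (metis power_mult mult.commute power_one)
  qed
  show ?thesis
  proof (cases "T *v y = \<omega> *s y")
    case True
    then show ?thesis using that[of y \<omega>] y \<omega>3 by simp
  next
    case neq: False
    define z where "z = T *v y - \<omega> *s y"
    have "T *v z = (- \<omega> - 1) *s (T *v y) - y"
      by (simp add: z_def vec.diff vec.scale T2y vec_eq_iff algebra_simps)
    then have "T *v z = \<omega>\<^sup>2 *s z"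
      using \<omega>3(1) unfolding \<omega>[symmetric]
      by (simp add: z_def vec.scale_right_diff_distrib power3_eq_cube power2_eq_square)
    moreover have "z \<noteq> 0" using neq by (simp add: z_def)
    moreover have "z \<in> U"
      unfolding z_def by (intro vec.subspace_diff vec.subspace_scale U y)
    ultimately show ?thesis using that[of z "\<omega>\<^sup>2"] \<omega>3 by simp
  qed
qed

text \<open>
  Vectors with distinct pairs of eigenvalues may share an eigenvalue of \<open>A\<close> or one of \<open>B\<close>, so the
  induction step applies \<open>A - a i\<close> and \<open>B - b i\<close> to the relation and combines what they give.
\<close>

lemma joint_eigenvectors_independent:
  fixes A B :: "'k::field ^ 'n ^ 'n::finite"
  assumes "finite I" "inj_on (\<lambda>i. (a i, b i)) I"
    and "\<And>i. i \<in> I \<Longrightarrow> v i \<noteq> 0 \<and> A *v v i = a i *s v i \<and> B *v v i = b i *s v i"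
    and "(\<Sum>i\<in>I. c i *s v i) = 0"
  shows "\<forall>i\<in>I. c i = 0"
  using assms
proof (induction I arbitrary: c rule: finite_induct)
  case (insert i I)
  have other: "c j = 0" if "j \<in> I" for j
  proof -
    have kill: "\<forall>j\<in>I. c j * (t j - t i) = 0"
      if t: "\<And>j. j \<in> insert i I \<Longrightarrow> T *v v j = t j *s v j" for T :: "'k ^ 'n ^ 'n" and t
    proof (rule insert.IH)
      have "(\<Sum>j\<in>insert i I. (c j * (t j - t i)) *s v j)
          = T *v (\<Sum>j\<in>insert i I. c j *s v j) - t i *s (\<Sum>j\<in>insert i I. c j *s v j)"
        unfolding vec.sum vec.scale_sum_right sum_subtractf[symmetric]
        by (intro sum.cong refl) (simp add: vec.scale t vec_eq_iff algebra_simps)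
      then show "(\<Sum>j\<in>I. (c j * (t j - t i)) *s v j) = 0"
        using insert.prems(3) insert.hyps by simp
    qed (use insert.prems in \<open>auto simp: inj_on_def\<close>)
    have "(a j, b j) \<noteq> (a i, b i)"
      using insert.prems(1) insert.hyps \<open>j \<in> I\<close> by (auto simp: inj_on_def)
    then show ?thesis
      using kill[of A a] kill[of B b] insert.prems(2) \<open>j \<in> I\<close> by auto
  qed
  then have "c i *s v i = 0" using insert.prems(3) insert.hyps by simp
  then show ?case using other insert.prems(2) by auto
qed simp

section \<open>Quartics with symmetry of type \<open>3\<^sup>2 : 4\<close>\<close>

text \<open>
  The relations make \<open>S\<close> map a joint eigenvector with eigenvalues \<open>(c, d)\<close> to one with eigenvalues
  \<open>(1/d, c)\<close>. A single eigenvector \<open>v\<close> on which \<open>A\<close> is not trivial thus yields a basis, and \<open>v\<close> turns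
  out to be a singular point.
\<close>

lemma no_invariant_nonsingular_quartic:
  fixes f :: "('k::{alg_closed_field, field_char_0}, 4) mpoly" and A B S :: "'k ^ 4 ^ 4"
  assumes f: "homogeneous 4 f" "nonsingular f"
    and A3: "\<And>x. A *v (A *v (A *v x)) = x" and A1: "A *v x0 \<noteq> x0"
    and AB: "\<And>x. A *v (B *v x) = B *v (A *v x)"
    and SA: "\<And>x. S *v (A *v x) = B *v (S *v x)"
    and ASB: "\<And>x. A *v (S *v (B *v x)) = S *v x"
    and S: "invertible S"
    and fA: "\<And>x. mpoly_eval f (A *v x) = mpoly_eval f x"
    and fB: "\<And>x. mpoly_eval f (B *v x) = mpoly_eval f x"
  shows False
proof -
  obtain S' where S': "S' ** S = mat 1" "S ** S' = mat 1" using S unfolding invertible_def by blast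
  have S0: "S *v x \<noteq> 0" if "x \<noteq> 0" for x
    using S'(1) that by (metis matrix_vector_mul_assoc matrix_vector_mul_lid matrix_vector_mult_0_right)
  have SS': "S *v (S' *v x) = x" for x
    by (simp add: matrix_vector_mul_assoc S')
  have B3: "B *v (B *v (B *v x)) = x" for x
  proof -
    have "B *v (B *v (B *v (S *v (S' *v x)))) = S *v (S' *v x)"
      by (simp only: SA[symmetric] A3)
    then show ?thesis by (simp only: SS')
  qed
  \<comment> \<open>On the image of \<open>A - 1\<close> the eigenvalue \<open>1\<close> does not occur, because \<open>1 + A + A\<^sup>2\<close> vanishes there.\<close>
  have subspace_range: "vec.subspace (range (\<lambda>x. A *v x - x))"
    unfolding vec.subspace_def image_iff
  proof (intro conjI ballI allI; clarsimp)
    show "\<exists>x. A *v x = x" by (rule exI[of _ 0]) simp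
    show "\<exists>z. A *v x - x + (A *v y - y) = A *v z - z" for x y
      by (rule exI[of _ "x + y"]) (simp add: vec.add)
    show "\<exists>z. c *s (A *v x - x) = A *v z - z" for c x
      by (rule exI[of _ "c *s x"]) (simp add: vec.scale vec.scale_right_diff_distrib)
  qed
  obtain v1 a where v1: "v1 \<in> range (\<lambda>x. A *v x - x)" "v1 \<noteq> 0" and a3: "a ^ 3 = 1" and Av1: "A *v v1 = a *s v1"
  proof (rule exists_eigenvector_of_order_three[OF A3 subspace_range])
    show "A *v x \<in> range (\<lambda>x. A *v x - x)" if "x \<in> range (\<lambda>x. A *v x - x)" for x
      using that by (auto simp: vec.diff)
    show "A *v x0 - x0 \<in> range (\<lambda>x. A *v x - x)" by blast
  qed (use A1 in auto)
  have a1: "a \<noteq> 1"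
  proof
    assume "a = 1"
    obtain x where x: "v1 = A *v x - x" using v1 by blast
    have "v1 + A *v v1 + A *v (A *v v1) = 0"
      unfolding x by (simp add: vec.diff A3)
    then have "v1 + v1 + v1 = 0" using Av1 \<open>a = 1\<close> by simp
    then have "3 * v1 $ i = 0" for i
      by (simp add: vec_eq_iff algebra_simps)
    then show False using v1(2) by (simp add: vec_eq_iff)
  qed
  have "vec.subspace {x. A *v x = a *s x}"
    by (auto simp: vec.subspace_def vec.add vec.scale vec.scale_right_distrib vec_eq_iff algebra_simps)
  then obtain v b where Av: "A *v v = a *s v" and v: "v \<noteq> 0" and b3: "b ^ 3 = 1" and Bv: "B *v v = b *s v"
  proof (rule exists_eigenvector_of_order_three[OF B3])
    show "B *v x \<in> {x. A *v x = a *s x}" if "x \<in> {x. A *v x = a *s x}" for x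
      using that by (simp add: AB vec.scale)
    show "v1 \<in> {x. A *v x = a *s x}" using Av1 by simp
  qed (use v1 in auto)
  have nz: "a \<noteq> 0" "b \<noteq> 0" using a3 b3 by auto
  have step: "A *v (S *v x) = inverse d *s (S *v x)" "B *v (S *v x) = c *s (S *v x)"
    if "A *v x = c *s x" "B *v x = d *s x" "d \<noteq> 0" for x c d
  proof -
    show "B *v (S *v x) = c *s (S *v x)" by (simp add: SA[symmetric] that vec.scale)
    have "d *s (A *v (S *v x)) = S *v x" using ASB[of x] by (simp add: that vec.scale)
    then have "inverse d *s (d *s (A *v (S *v x))) = inverse d *s (S *v x)" by simp
    then show "A *v (S *v x) = inverse d *s (S *v x)" using that by simp
  qed
  \<comment> \<open>The elements of the index type are \<open>1, 2, 3, 4\<close>, so the last branch is the index \<open>4\<close>.\<close>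
  define w :: "4 \<Rightarrow> 'k ^ 4" where "w = (\<lambda>i. if i = 1 then v else if i = 2 then S *v v
      else if i = 3 then S *v (S *v v) else S *v (S *v (S *v v)))"
  define \<alpha> :: "4 \<Rightarrow> 'k" where "\<alpha> = (\<lambda>i. if i = 1 then a else if i = 2 then inverse b
      else if i = 3 then inverse a else b)"
  define \<beta> :: "4 \<Rightarrow> 'k" where "\<beta> = (\<lambda>i. if i = 1 then b else if i = 2 then a
      else if i = 3 then inverse b else inverse a)"
  note e1 = step[OF Av Bv nz(2)]
  note e2 = step[OF e1 nz(1)]
  have "inverse b \<noteq> 0" using nz by simp
  note e3 = step[OF e2 this]
  have w: "w i \<noteq> 0 \<and> A *v w i = \<alpha> i *s w i \<and> B *v w i = \<beta> i *s w i" for i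
    using e1 e2 e3 Av Bv v S0 by (simp add: w_def \<alpha>_def \<beta>_def)
  have aa: "a \<noteq> inverse a" 
  proof
    assume "a = inverse a"
    then have "a * a = 1" using nz by (metis right_inverse)
    then show False using a3 a1 by (simp add: power3_eq_cube)
  qed
  have inj: "inj (\<lambda>i. (\<alpha> i, \<beta> i))"
  proof -
    have "\<forall>i j. (\<alpha> i, \<beta> i) = (\<alpha> j, \<beta> j) \<longrightarrow> i = j"
      unfolding forall_4 \<alpha>_def \<beta>_def using aa nz a1 by auto
    then show ?thesis by (auto simp: inj_def)
  qed
  have nontrivial: "\<alpha> i \<noteq> 1 \<or> \<beta> i \<noteq> 1" for i
    using a1 by (auto simp: \<alpha>_def \<beta>_def)
  \<comment> \<open>The derivative of \<open>f\<close> at \<open>v\<close>.\<close>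
  define l where "l = (\<lambda>x::'k ^ 4. \<Sum>i\<in>UNIV. mpoly_eval (partial_deriv i f) v * x $ i)"
  have lw: "l (w i) = 0" for i
  proof -
    have "l (w i) = a ^ (4 - 1) * \<alpha> i * l (w i)" unfolding l_def
      by (rule gradient_along_eigenvectors[OF f(1) _ fA Av _ nz(1)]) (use w in auto)
    moreover have "l (w i) = b ^ (4 - 1) * \<beta> i * l (w i)" unfolding l_def
      by (rule gradient_along_eigenvectors[OF f(1) _ fB Bv _ nz(2)]) (use w in auto)
    ultimately show ?thesis using nontrivial[of i] a3 b3 by auto
  qed
  define M :: "'k ^ 4 ^ 4" where "M = (\<chi> i j. w j $ i)"
  have M: "M *v c = (\<Sum>j\<in>UNIV. (c $ j) *s w j)" for c
    by (simp add: M_def matrix_vector_mult_def vec_eq_iff mult.commute)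
  have "c = 0" if "M *v c = 0" for c
    using joint_eigenvectors_independent[OF finite inj w, of "\<lambda>j. c $ j"] that
    by (simp add: M vec_eq_iff)
  then obtain N where "N ** M = mat 1" using matrix_left_invertible_ker by blast
  then have MN: "M ** N = mat 1" using matrix_left_right_inverse by blast
  have l0: "l x = 0" for x
  proof -
    have "x = M *v (N *v x)" by (simp add: matrix_vector_mul_assoc MN)
    also have "\<dots> = (\<Sum>j\<in>UNIV. ((N *v x) $ j) *s w j)" by (rule M)
    finally have "l x = (\<Sum>i\<in>UNIV. mpoly_eval (partial_deriv i f) v * (\<Sum>j\<in>UNIV. ((N *v x) $ j) * w j $ i))"
      unfolding l_def by (simp add: vec_eq_iff)
    also have "\<dots> = (\<Sum>j\<in>UNIV. ((N *v x) $ j) * l (w j))"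
      unfolding l_def sum_distrib_left by (subst sum.swap) (simp add: mult_ac)
    finally show ?thesis by (simp add: lw)
  qed
  have "mpoly_eval f v = a ^ 4 * mpoly_eval f v"
    using fA[of v] by (simp add: Av mpoly_eval_homogeneous[OF f(1)])
  moreover have "a ^ 4 = a" using a3 by (simp add: eval_nat_numeral)
  ultimately have "mpoly_eval f v = 0" using a1 by simp
  then obtain i where i: "mpoly_eval (partial_deriv i f) v \<noteq> 0"
    using nonsingular_gradient[OF f v] by blast
  have "l (axis i 1) = mpoly_eval (partial_deriv i f) v"
    by (simp add: l_def axis_def if_distrib[where f = "(*) _"] sum.delta cong: if_cong)
  then show False using i l0 by simp
qed

text \<open>
  The factors \<open>cA\<close> and \<open>cB\<close> by which \<open>A\<close> and \<open>B\<close> scale \<open>f\<close> agree since the matrices are conjugate,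
  and are inverse to each other since \<open>B\<close> is also conjugate to the inverse of \<open>A\<close>. So their square
  and their cube are \<open>1\<close>.
\<close>

lemma no_nonsingular_quartic_with_stable_zero_set:
  fixes f :: "('k::{alg_closed_field, field_char_0}, 4) mpoly" and A B S :: "'k ^ 4 ^ 4"
  assumes f: "homogeneous 4 f" "nonsingular f"
    and A3: "\<And>x. A *v (A *v (A *v x)) = x" and A1: "A *v x0 \<noteq> x0"
    and AB: "\<And>x. A *v (B *v x) = B *v (A *v x)"
    and SA: "\<And>x. S *v (A *v x) = B *v (S *v x)"
    and ASB: "\<And>x. A *v (S *v (B *v x)) = S *v x"
    and S: "invertible S"
    and zA: "\<And>x. mpoly_eval f x = 0 \<Longrightarrow> mpoly_eval f (A *v x) = 0"
    and zB: "\<And>x. mpoly_eval f x = 0 \<Longrightarrow> mpoly_eval f (B *v x) = 0"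
    and zS: "\<And>x. mpoly_eval f x = 0 \<Longrightarrow> mpoly_eval f (S *v x) = 0"
  shows False
proof -
  obtain p where p: "mpoly_eval f p \<noteq> 0" using exists_nonvanishing_point[OF f] by blast
  have character: "\<exists>c. \<forall>x. mpoly_eval f (T *v x) = c * mpoly_eval f x"
    if "\<And>x. mpoly_eval f x = 0 \<Longrightarrow> mpoly_eval f (T *v x) = 0" for T
    using zero_set_symmetry_scales_nonsingular_form[OF f(1) _ f(2) that p] p
    by (intro exI[of _ "mpoly_eval f (T *v p) / mpoly_eval f p"]) (simp add: field_simps)
  obtain cA where cA: "\<And>x. mpoly_eval f (A *v x) = cA * mpoly_eval f x" using character[OF zA] by auto
  obtain cB where cB: "\<And>x. mpoly_eval f (B *v x) = cB * mpoly_eval f x" using character[OF zB] by auto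
  obtain cS where cS: "\<And>x. mpoly_eval f (S *v x) = cS * mpoly_eval f x" using character[OF zS] by auto
  have "cS \<noteq> 0"
  proof
    assume "cS = 0"
    obtain S' where "S ** S' = mat 1" using S unfolding invertible_def by blast
    then have "S *v (S' *v p) = p" by (simp add: matrix_vector_mul_assoc)
    then show False using cS[of "S' *v p"] p \<open>cS = 0\<close> by simp
  qed
  have "cA * (cA * cA) = 1"
    using arg_cong[OF A3[of p], of "mpoly_eval f"] p by (simp add: cA)
  moreover have "cA = cB"
    using arg_cong[OF SA[of p], of "mpoly_eval f"] p \<open>cS \<noteq> 0\<close> by (simp add: cA cB cS)
  moreover have "cA * cB = 1"
    using arg_cong[OF ASB[of p], of "mpoly_eval f"] p \<open>cS \<noteq> 0\<close> by (simp add: cA cB cS)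
  ultimately have "cA = 1" "cB = 1" by auto
  then show False
    using no_invariant_nonsingular_quartic[OF f A3 A1 AB SA ASB S] cA cB by simp
qed

lemma det_mat: "det (mat c :: 'a::comm_ring_1 ^ 'n ^ 'n::finite) = c ^ CARD('n)"
  by (subst det_diagonal) (auto simp: mat_def)

text \<open>
  The scalars in the relations are removed by rescaling. The relations force \<open>c4\<^sup>2 = (c1 c2)\<^sup>3\<close>, so
  \<open>a = c4 / (c1 c2)\<close> satisfies both \<open>a\<^sup>2 = c1 c2\<close> and \<open>a\<^sup>3 = c4\<close>, which is what normalizing \<open>A\<close> to
  \<open>A / a\<close> and \<open>B\<close> to \<open>c1 B / a\<close> requires. The commutator scalar \<open>c3\<close> satisfies \<open>c3\<^sup>3 = 1\<close> as
  \<open>A\<^sup>3\<close> is scalar, and \<open>c3\<^sup>4 = 1\<close> by determinants in dimension four, so \<open>A\<close> and \<open>B\<close> commute.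
\<close>

lemma no_nonsingular_quartic_with_projective_symmetries:
  fixes f :: "('k::{alg_closed_field, field_char_0}, 4) mpoly" and A B S :: "'k ^ 4 ^ 4"
  assumes f: "homogeneous 4 f" "nonsingular f"
    and inv: "invertible A" "invertible B" "invertible S"
    and nz: "c1 \<noteq> 0" "c2 \<noteq> 0" "c3 \<noteq> 0" "c4 \<noteq> 0"
    and SA: "S ** A = mat c1 ** (B ** S)"
    and ASB: "A ** S ** B = mat c2 ** S"
    and AB: "A ** B = mat c3 ** (B ** A)"
    and A3: "A ** A ** A = mat c4"
    and A_nonscalar: "\<And>c. A \<noteq> mat c"
    and zA: "\<And>x. mpoly_eval f x = 0 \<Longrightarrow> mpoly_eval f (A *v x) = 0"
    and zB: "\<And>x. mpoly_eval f x = 0 \<Longrightarrow> mpoly_eval f (B *v x) = 0"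
    and zS: "\<And>x. mpoly_eval f x = 0 \<Longrightarrow> mpoly_eval f (S *v x) = 0"
  shows False
proof -
  have vSA: "S *v (A *v x) = c1 *s (B *v (S *v x))" for x
    using arg_cong[OF SA, of "\<lambda>M. M *v x"] by (simp add: mat_vector_mult flip: matrix_vector_mul_assoc)
  have vASB: "A *v (S *v (B *v x)) = c2 *s (S *v x)" for x
    using arg_cong[OF ASB, of "\<lambda>M. M *v x"] by (simp add: mat_vector_mult flip: matrix_vector_mul_assoc)
  have vAB: "A *v (B *v x) = c3 *s (B *v (A *v x))" for x
    using arg_cong[OF AB, of "\<lambda>M. M *v x"] by (simp add: mat_vector_mult flip: matrix_vector_mul_assoc)
  have vA3: "A *v (A *v (A *v x)) = c4 *s x" for x
    using arg_cong[OF A3, of "\<lambda>M. M *v x"] by (simp add: mat_vector_mult flip: matrix_vector_mul_assoc)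
  have S0: "S *v x \<noteq> 0" and B0: "B *v x \<noteq> 0" if "x \<noteq> 0" for x
    using that inv unfolding invertible_def
    by (metis matrix_vector_mul_assoc matrix_vector_mul_lid matrix_vector_mult_0_right)+
  have cancel: "c = d" if "c *s x = d *s x" "x \<noteq> 0" for c d and x :: "'k ^ 4"
    using that by (simp add: vec.scale_right_imp_eq)
  define x1 :: "'k ^ 4" where "x1 = 1"
  have x1: "x1 \<noteq> 0" by (simp add: x1_def)
  have B3: "c1 ^ 3 *s (B *v (B *v (B *v y))) = c4 *s y" for y
  proof -
    obtain S' where "S ** S' = mat 1" using inv(3) unfolding invertible_def by blast
    then have y: "S *v (S' *v y) = y" by (simp add: matrix_vector_mul_assoc)
    have "S *v (A *v (A *v (A *v (S' *v y)))) = c1 ^ 3 *s (B *v (B *v (B *v y)))"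
      by (simp add: vSA vec.scale power3_eq_cube y)
    then show ?thesis by (simp add: vA3 vec.scale y)
  qed
  have c123: "c4 ^ 2 = (c1 * c2) ^ 3"
  proof -
    have "A *v (A *v (A *v (S *v (B *v (B *v (B *v x1)))))) = c2 ^ 3 *s (S *v x1)"
      by (simp add: vASB vec.scale power3_eq_cube)
    then have "c1 ^ 3 *s (c4 *s (S *v (B *v (B *v (B *v x1))))) = c1 ^ 3 *s (c2 ^ 3 *s (S *v x1))"
      by (simp add: vA3)
    moreover have "c1 ^ 3 *s (c4 *s (S *v (B *v (B *v (B *v x1)))))
        = c4 *s (S *v (c1 ^ 3 *s (B *v (B *v (B *v x1)))))"
      by (simp add: vec.scale mult.commute)
    ultimately have "(c4 * c4) *s (S *v x1) = (c1 ^ 3 * c2 ^ 3) *s (S *v x1)"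
      by (auto simp: B3 vec.scale)
    from cancel[OF this S0[OF x1]] show ?thesis
      by (simp add: power2_eq_square power_mult_distrib)
  qed
  have c3: "c3 = 1"
  proof -
    have "det A * det B = c3 ^ 4 * (det B * det A)"
      using arg_cong[OF AB, of det] by (simp add: det_mul det_mat)
    moreover have "det A \<noteq> 0" "det B \<noteq> 0" using inv by (simp_all add: invertible_det_nz)
    ultimately have "c3 ^ 4 = 1" by (simp add: mult.commute)
    moreover have "c3 ^ 3 = 1"
    proof -
      have "A *v (A *v (A *v (B *v x1))) = c3 ^ 3 *s (B *v (A *v (A *v (A *v x1))))"
        by (simp add: vAB vec.scale power3_eq_cube)
      then have "c4 *s (B *v x1) = (c3 ^ 3 * c4) *s (B *v x1)"
        by (simp add: vA3 vec.scale)
      from cancel[OF this B0[OF x1]] show ?thesis using nz by simp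
    qed
    ultimately show ?thesis by (simp add: eval_nat_numeral)
  qed
  define a where "a = c4 / (c1 * c2)"
  define b where "b = a / c1"
  have ab: "a \<noteq> 0" "b \<noteq> 0" using nz by (simp_all add: a_def b_def)
  have a2: "a * a = c1 * c2" 
    using c123 nz by (simp add: a_def field_simps power2_eq_square power3_eq_cube)
  have a3: "a * (a * a) = c4" using nz unfolding a2 by (simp add: a_def)
  define A' where "A' = mat (1 / a) ** A"
  define B' where "B' = mat (1 / b) ** B"
  have A': "A' *v x = (1 / a) *s (A *v x)" for x
    by (simp add: A'_def mat_vector_mult flip: matrix_vector_mul_assoc)
  have B': "B' *v x = (1 / b) *s (B *v x)" for x
    by (simp add: B'_def mat_vector_mult flip: matrix_vector_mul_assoc)
  have "\<exists>x. A' *v x \<noteq> x"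
  proof (rule ccontr)
    assume "\<not> ?thesis"
    then have "A *v x = a *s x" for x using A'[of x] ab
      by (metis nonzero_divide_eq_eq vec.scale_one vec.scale_scale mult.commute)
    then have "A = mat a" by (simp add: matrix_eq mat_vector_mult)
    then show False using A_nonscalar by blast
  qed
  then obtain x0 where "A' *v x0 \<noteq> x0" by blast
  moreover have "A' *v (A' *v (A' *v x)) = x" for x
    using ab a3 nz by (simp add: A' vec.scale vA3 flip: mult.assoc)
  moreover have "A' *v (B' *v x) = B' *v (A' *v x)" for x
    by (simp add: A' B' vec.scale vAB c3 mult.commute)
  moreover have "S *v (A' *v x) = B' *v (S *v x)" for x
    using ab nz by (simp add: A' B' vec.scale vSA b_def)
  moreover have "A' *v (S *v (B' *v x)) = S *v x" for x
    using ab nz by (simp add: A' B' vec.scale vASB b_def a2)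
  moreover have "mpoly_eval f (A' *v x) = 0" "mpoly_eval f (B' *v x) = 0" if "mpoly_eval f x = 0" for x
    using zA[OF that] zB[OF that] by (simp_all add: A' B' mpoly_eval_homogeneous[OF f(1)])
  ultimately show False
    using no_nonsingular_quartic_with_stable_zero_set[OF f, of A' x0 B' S] inv(3) zS by blast
qed

section \<open>From projective classes to matrices\<close>

abbreviation proj_class :: "'k::field ^ 'n ^ 'n::finite \<Rightarrow> ('k ^ 'n ^ 'n) set" where
  "proj_class A \<equiv> scalar_matrices #>\<^bsub>GL\<^esub> A"

lemma carrier_PGL: "carrier PGL = proj_class ` {A. invertible A}"
  by (simp add: PGL_def carrier_FactGroup) (simp add: GL_def)

lemma mult_proj_class:
  fixes A B :: "'k::field ^ 'n ^ 'n::finite"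
  assumes "invertible A" "invertible B"
  shows "proj_class A \<otimes>\<^bsub>PGL\<^esub> proj_class B = proj_class (A ** B)"
  using normal.rcos_sum[OF normal_scalar_matrices, of A B] assms
  by (simp add: PGL_def) (simp add: GL_def)

lemma proj_class_eqD:
  fixes A B :: "'k::field ^ 'n ^ 'n::finite"
  assumes "proj_class A = proj_class B"
  obtains c where "c \<noteq> 0" "A = mat c ** B"
proof -
  have "A = mat 1 ** A" by simp
  moreover have "mat 1 \<in> (scalar_matrices :: ('k ^ 'n ^ 'n) set)"
    by (auto simp: scalar_matrices_def intro: exI[of _ 1])
  ultimately have "A \<in> proj_class A"
    by (auto simp: r_coset_def GL_def intro!: bexI[of _ "mat 1"])
  then have "A \<in> proj_class B" using assms by simp
  then show ?thesis using that by (auto simp: r_coset_def scalar_matrices_def GL_def)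
qed

lemma proj_class_mat_mult:
  fixes A :: "'k::field ^ 'n ^ 'n::finite"
  assumes "c \<noteq> 0"
  shows "proj_class (mat c ** A) = proj_class A"
proof -
  have "\<exists>d'. d' \<noteq> 0 \<and> mat d ** A = mat d' ** (mat c ** A)" if "d \<noteq> 0" for d
    using assms that by (intro exI[of _ "d / c"]) (simp add: matrix_mul_assoc mat_mult_mat)
  moreover have "\<exists>d'. d' \<noteq> 0 \<and> mat d ** (mat c ** A) = mat d' ** A" if "d \<noteq> 0" for d
    using assms that by (intro exI[of _ "d * c"]) (simp add: matrix_mul_assoc mat_mult_mat)
  ultimately show ?thesis
    by (auto simp: r_coset_def scalar_matrices_def GL_def) metis+
qed

lemma zero_set_stable_if_in_Paut:
  fixes A :: "'k::field ^ 'n ^ 'n::finite"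
  assumes f: "homogeneous d f" and A: "invertible A" "proj_class A \<in> carrier (Paut f)"
    and x: "mpoly_eval f x = 0"
  shows "mpoly_eval f (A *v x) = 0"
proof (cases "x = 0")
  case False
  then have "proj_point x \<in> hypersurface f"
    using x by (simp add: proj_point_in_hypersurface[OF f])
  then have "proj_act (proj_class A) (proj_point x) \<in> hypersurface f"
    using A(2) by (auto simp: Paut_def)
  then show ?thesis
    using mem_proj_point[of "A *v x"] by (auto simp: proj_act_class hypersurface_def)
qed (use x in simp)

text \<open>
  In a group the hypotheses say that \<open>a\<close> has order three and commutes with \<open>b\<close>, and that conjugation
  by \<open>s\<close> maps \<open>a\<close> to \<open>b\<close> and \<open>b\<close> to the inverse of \<open>a\<close>. They are written without the unit and
  inverses of \<open>K\<close>, so that each can be transported to representing matrices by multiplicativity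
  alone: \<open>a\<^sup>4 = a\<close> stands for \<open>a\<^sup>3 = 1\<close>, and
  \<open>a s b = s\<close> for \<open>s b = a\<^sup>-\<^sup>1 s\<close>.
\<close>

lemma no_nonsingular_quartic_with_nine_four_symmetry:
  fixes f :: "('k::{alg_closed_field, field_char_0}, 4) mpoly" and K :: "('c, 'd) monoid_scheme"
  assumes f: "nonsingular_quartic f" and K: "contains_subgroup_iso (Paut f) K"
    and abs: "a \<in> carrier K" "b \<in> carrier K" "s \<in> carrier K"
    and sa: "s \<otimes>\<^bsub>K\<^esub> a = b \<otimes>\<^bsub>K\<^esub> s"
    and asb: "(a \<otimes>\<^bsub>K\<^esub> s) \<otimes>\<^bsub>K\<^esub> b = s"
    and ab: "a \<otimes>\<^bsub>K\<^esub> b = b \<otimes>\<^bsub>K\<^esub> a"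
    and a4: "((a \<otimes>\<^bsub>K\<^esub> a) \<otimes>\<^bsub>K\<^esub> a) \<otimes>\<^bsub>K\<^esub> a = a"
    and a2: "a \<otimes>\<^bsub>K\<^esub> a \<noteq> a"
  shows False
proof -
  have f4: "homogeneous 4 f" "nonsingular f" using f by (auto simp: nonsingular_quartic_def)
  obtain H h where H: "subgroup H (Paut f)" and h: "h \<in> iso ((Paut f)\<lparr>carrier := H\<rparr>) K"
    using K unfolding contains_subgroup_iso_def is_iso_def by blast
  have bij: "bij_betw h H (carrier K)" using h by (simp add: iso_def)
  have mult_eq: "mult (Paut f) = mult (PGL :: ('k ^ 4 ^ 4) set monoid)" by (simp add: Paut_def)
  have h_mult: "h (C \<otimes>\<^bsub>PGL\<^esub> D) = h C \<otimes>\<^bsub>K\<^esub> h D" if "C \<in> H" "D \<in> H" for C D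
    using h that by (simp add: iso_def hom_def mult_eq)
  have H_mult: "C \<otimes>\<^bsub>PGL\<^esub> D \<in> H" if "C \<in> H" "D \<in> H" for C D
    using subgroup.m_closed[OF H that] by (simp add: mult_eq)
  have lift: "\<exists>A. invertible A \<and> proj_class A \<in> H \<and> h (proj_class A) = x" if "x \<in> carrier K" for x
  proof -
    have "x \<in> h ` H" using bij that by (simp add: bij_betw_def)
    then obtain C where C: "C \<in> H" "x = h C" by (rule imageE)
    have "C \<in> carrier (Paut f)" using subgroup.subset[OF H] C(1) by (rule subsetD)
    then have "C \<in> carrier PGL" by (simp add: Paut_def)
    then obtain A where "invertible A" "C = proj_class A" unfolding carrier_PGL by auto
    then show ?thesis using C by auto
  qed
  obtain A where A: "invertible A" "proj_class A \<in> H" "h (proj_class A) = a" using lift[OF abs(1)] by blast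
  obtain B where B: "invertible B" "proj_class B \<in> H" "h (proj_class B) = b" using lift[OF abs(2)] by blast
  obtain S where S: "invertible S" "proj_class S \<in> H" "h (proj_class S) = s" using lift[OF abs(3)] by blast
  define represents where "represents = (\<lambda>M x. invertible M \<and> proj_class M \<in> H \<and> h (proj_class M) = x)"
  have represents: "represents A a" "represents B b" "represents S s" using A B S by (auto simp: represents_def)
  have represents_mult: "represents (M ** N) (x \<otimes>\<^bsub>K\<^esub> y)" if "represents M x" "represents N y" for M N x y
    using that H_mult h_mult by (auto simp: represents_def invertible_mult simp flip: mult_proj_class)
  have represents_eq: "\<exists>c. c \<noteq> 0 \<and> M = mat c ** N" if "represents M x" "represents N x" for M N x
  proof -
    have "proj_class M = proj_class N"
      using that bij unfolding represents_def bij_betw_def inj_on_def by blast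
    then show ?thesis by (metis proj_class_eqD)
  qed
  obtain c1 where c1: "c1 \<noteq> 0" "S ** A = mat c1 ** (B ** S)"
    using represents_eq[OF represents_mult[OF represents(3,1)]] represents_mult[OF represents(2,3)] sa by metis
  obtain c2 where c2: "c2 \<noteq> 0" "A ** S ** B = mat c2 ** S"
    using represents_eq[OF represents_mult[OF represents_mult[OF represents(1,3)] represents(2)]] represents(3) asb by metis
  obtain c3 where c3: "c3 \<noteq> 0" "A ** B = mat c3 ** (B ** A)"
    using represents_eq[OF represents_mult[OF represents(1,2)]] represents_mult[OF represents(2,1)] ab by metis
  obtain c4 where c4: "c4 \<noteq> 0" "A ** A ** A ** A = mat c4 ** A"
    using represents_eq[OF represents_mult[OF represents_mult[OF represents_mult[OF represents(1,1)] represents(1)] represents(1)]] represents(1) a4 by metis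
  have A3: "A ** A ** A = mat c4"
  proof -
    obtain A' where A': "A ** A' = mat 1" using A(1) unfolding invertible_def by blast
    have "A ** A ** A ** (A ** A') = mat c4 ** (A ** A')"
      using c4(2) by (simp add: matrix_mul_assoc)
    then show ?thesis by (simp add: A')
  qed
  have A_nonscalar: "A \<noteq> mat c" for c
  proof
    assume Ac: "A = mat c"
    have "c \<noteq> 0"
    proof
      assume "c = 0"
      then have "A *v 1 = 0" by (simp add: Ac mat_vector_mult)
      then show False using A(1) unfolding invertible_def
        by (metis matrix_vector_mul_assoc matrix_vector_mul_lid matrix_vector_mult_0_right zero_neq_one)
    qed
    then have "proj_class (A ** A) = proj_class A"
      unfolding Ac by (rule proj_class_mat_mult)
    then show False using represents_mult[OF represents(1,1)] represents(1) a2 by (auto simp: represents_def)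
  qed
  have stable: "mpoly_eval f (M *v x) = 0" if "represents M y" "mpoly_eval f x = 0" for M x y
    using zero_set_stable_if_in_Paut[OF f4(1)] that subgroup.subset[OF H] unfolding represents_def by blast
  show False
    by (rule no_nonsingular_quartic_with_projective_symmetries[OF f4 A(1) B(1) S(1)
          c1(1) c2(1) c3(1) c4(1) c1(2) c2(2) c3(2) A3 A_nonscalar
          stable[OF represents(1)] stable[OF represents(2)] stable[OF represents(3)]])
qed

section \<open>The alternating and symmetric groups of degree six\<close>

text \<open>
  The witnesses are \<open>a = (1 2 3)\<close>, \<open>b = (4 5 6)\<close> and \<open>s = (1 4)(2 5 3 6)\<close>, written as products of an
  even number of transpositions.
\<close>

lemma nine_four_permutations_of_six_points:
  obtains a b s :: "nat \<Rightarrow> nat" where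
    "a permutes {1..6}" "b permutes {1..6}" "s permutes {1..6}"
    "evenperm a" "evenperm b" "evenperm s"
    "s \<circ> a = b \<circ> s" "(a \<circ> s) \<circ> b = s" "a \<circ> b = b \<circ> a"
    "((a \<circ> a) \<circ> a) \<circ> a = a" "a \<circ> a \<noteq> a"
proof
  let ?a = "Transposition.transpose 1 2 \<circ> Transposition.transpose 2 (3::nat)"
  let ?b = "Transposition.transpose 4 5 \<circ> Transposition.transpose 5 (6::nat)"
  let ?s = "(Transposition.transpose 1 4 \<circ> Transposition.transpose 2 5) \<circ>
    (Transposition.transpose 5 3 \<circ> Transposition.transpose 3 (6::nat))"
  show "?a permutes {1..6}" "?b permutes {1..6}" "?s permutes {1..6}"
    by (intro permutes_compose permutes_swap_id; simp)+
  show "evenperm ?a" "evenperm ?b" "evenperm ?s"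
    by (simp_all add: evenperm_comp evenperm_swap permutation_swap_id permutation_compose)
  show "?s \<circ> ?a = ?b \<circ> ?s" "(?a \<circ> ?s) \<circ> ?b = ?s" "?a \<circ> ?b = ?b \<circ> ?a"
    "((?a \<circ> ?a) \<circ> ?a) \<circ> ?a = ?a"
    by (auto simp: fun_eq_iff Transposition.transpose_def)
  have "(?a \<circ> ?a) 1 \<noteq> ?a 1" by (simp add: Transposition.transpose_def)
  then show "?a \<circ> ?a \<noteq> ?a" by metis
qed

theorem lemma4p4:
  shows "\<not> (\<exists>f :: ('k::{alg_closed_field, field_char_0}, 4) mpoly.
               nonsingular_quartic f \<and> contains_subgroup_iso (Paut f) (alt_group 6))
       \<and> \<not> (\<exists>f :: ('k, 4) mpoly.
               nonsingular_quartic f \<and> contains_subgroup_iso (Paut f) (sym_group 6))"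
proof -
  obtain a b s :: "nat \<Rightarrow> nat" where perms:
    "a permutes {1..6}" "b permutes {1..6}" "s permutes {1..6}"
    "evenperm a" "evenperm b" "evenperm s"
    "s \<circ> a = b \<circ> s" "(a \<circ> s) \<circ> b = s" "a \<circ> b = b \<circ> a"
    "((a \<circ> a) \<circ> a) \<circ> a = a" "a \<circ> a \<noteq> a"
    by (rule nine_four_permutations_of_six_points)
  have False if "nonsingular_quartic f" "contains_subgroup_iso (Paut f) (alt_group 6)"
    for f :: "('k, 4) mpoly"
    by (rule no_nonsingular_quartic_with_nine_four_symmetry[OF that, of a b s])
      (use perms in \<open>simp_all add: alt_group_carrier alt_group_mult\<close>)
  moreover have False if "nonsingular_quartic f" "contains_subgroup_iso (Paut f) (sym_group 6)"
    for f :: "('k, 4) mpoly"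
    by (rule no_nonsingular_quartic_with_nine_four_symmetry[OF that, of a b s])
      (use perms in \<open>simp_all add: sym_group_carrier sym_group_mult\<close>)
  ultimately show ?thesis by blast
qed

end
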